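(* For every $p\in(1,2]$ there exist a constant $c_p\in(0,2)$ and sequences $\eta_n\to0$, $\eta'_n\to0$ (depending only on $p$) such that for every $n\in\mathbb{N}$ and every $\mathbf{k}$ as below there exists $$\alpha=(1+\eta_n)\frac{\log(2/c_p)\cdot n}{2^n}\quad\text{with}\quad f_{p,\mathbf{k},n}(\alpha)\ge-(1+\eta'_n)\log(2/c_p)\cdot n.$$
   Context: $\log$ is the natural logarithm. $\mathbf{k}=(k_1,\dots,k_{m+1})$ integers with $0=k_1<\cdots<k_{m+1}=n$. For $\mathbf{x}\in\mathbb{R}^n$ put $\mathbf{x}_j=(x_{k_j+1},\dots,x_{k_{j+1}})$, $\|\mathbf{x}\|_{p,\mathbf{k},n}=(\sum_{j=1}^m\|\mathbf{x}_j\|_2^p)^{1/p}$ ($\|\cdot\|_2$ Euclidean norm), $d(\mathbf{x},\mathbf{y})=\|\mathbf{y}-\mathbf{x}\|_{p,\mathbf{k},n}$, $B(\mathbf{x},r)=\{\mathbf{y}:d(\mathbf{x},\mathbf{y})\le r\}$, and $r_n$ is the radius with $\mathrm{vol}(B(\mathbf 0,r_n))=1$. For bounded measurable $S\subseteq\mathbb{R}^n$ and integer $t\ge1$ let $\hat Z_S(t)=\frac1{t!}\int_{S^t}\mathbf 1[d(\mathbf{x}_i,\mathbf{x}_j)\ge2r_n\ \forall i\ne j]\,d\mathbf{x}_1\cdots d\mathbf{x}_t$, $\hat Z_S(0)=1$. With $V=V(R)=\mathrm{vol}(B(\mathbf 0,R))=(R/r_n)^n$, the entropy density is $$f_{p,\mathbf{k},n}(\alpha)=\lim_{R\to\infty}\frac{1}{\alpha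 V}\log\frac{\hat Z_{B(\mathbf 0,R)}(\lfloor\alpha V\rfloor)}{V^{\lfloor\alpha V\rfloor}/\lfloor\alpha V\rfloor!}$$ (interpreted as $\liminf$ if the limit does not exist, with the convention $\log0=-\infty$). *)

theory Defs
  imports "HOL-Analysis.Analysis"
begin

text \<open>Points of R^n are functions nat => real restricted to the index set {..<n}
  (0-based: coordinate i of the paper is index i-1 here).  The partition
  0 = k_1 < ... < k_{m+1} = n is encoded as a function k :: nat => nat with
  k 0 = 0 < k 1 < ... < k m = n; block j (0-based, j < m) consists of the indices
  {k j ..< k (Suc j)}.\<close>

definition valid_blocks :: "nat \<Rightarrow> (nat \<Rightarrow> nat) \<Rightarrow> nat \<Rightarrow> bool" where
  "valid_blocks m k n \<longleftrightarrow> k 0 = 0 \<and> k m = n \<and> (\<forall>j<m. k j < k (Suc j))"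

definition Rn :: "nat \<Rightarrow> (nat \<Rightarrow> real) measure" where
  "Rn n = Pi\<^sub>M {..<n} (\<lambda>_. lborel)"

definition mixed_norm :: "real \<Rightarrow> (nat \<Rightarrow> nat) \<Rightarrow> nat \<Rightarrow> (nat \<Rightarrow> real) \<Rightarrow> real" where
  "mixed_norm p k m x =
     (\<Sum>j<m. (sqrt (\<Sum>i\<in>{k j..<k (Suc j)}. (x i)^2)) powr p) powr (1 / p)"

definition mdist :: "real \<Rightarrow> (nat \<Rightarrow> nat) \<Rightarrow> nat \<Rightarrow> (nat \<Rightarrow> real) \<Rightarrow> (nat \<Rightarrow> real) \<Rightarrow> real" where
  "mdist p k m x y = mixed_norm p k m (\<lambda>i. y i - x i)"

definition mball :: "real \<Rightarrow> (nat \<Rightarrow> nat) \<Rightarrow> nat \<Rightarrow> nat \<Rightarrow> (nat \<Rightarrow> real) \<Rightarrow> real \<Rightarrow> (nat \<Rightarrow> real) set" where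
  "mball p k m n x r = {y \<in> space (Rn n). mdist p k m x y \<le> r}"

definition rad :: "real \<Rightarrow> (nat \<Rightarrow> nat) \<Rightarrow> nat \<Rightarrow> nat \<Rightarrow> real" where
  "rad p k m n = (THE r. r > 0 \<and> emeasure (Rn n) (mball p k m n (\<lambda>_. 0) r) = 1)"

definition Zhat :: "real \<Rightarrow> (nat \<Rightarrow> nat) \<Rightarrow> nat \<Rightarrow> nat \<Rightarrow> (nat \<Rightarrow> real) set \<Rightarrow> nat \<Rightarrow> real" where
  "Zhat p k m n S t =
     (if t = 0 then 1 else
      measure (Pi\<^sub>M {..<t} (\<lambda>_. Rn n))
        {xs \<in> space (Pi\<^sub>M {..<t} (\<lambda>_. Rn n)).
           (\<forall>i<t. xs i \<in> S) \<and>
           (\<forall>i<t. \<forall>j<t. i \<noteq> j \<longrightarrow> mdist p k m (xs i) (xs j) \<ge> 2 * rad p k m n)}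
      / fact t)"

text \<open>V(R) = vol(B(0,R)) = (R / r_n)^n.\<close>
definition Vol :: "real \<Rightarrow> (nat \<Rightarrow> nat) \<Rightarrow> nat \<Rightarrow> nat \<Rightarrow> real \<Rightarrow> real" where
  "Vol p k m n R = (R / rad p k m n) ^ n"

definition entropy_term :: "real \<Rightarrow> (nat \<Rightarrow> nat) \<Rightarrow> nat \<Rightarrow> nat \<Rightarrow> real \<Rightarrow> real \<Rightarrow> ereal" where
  "entropy_term p k m n \<alpha> R =
     (let V = Vol p k m n R; N = nat \<lfloor>\<alpha> * V\<rfloor>;
          Z = Zhat p k m n (mball p k m n (\<lambda>_. 0) R) N
      in if Z = 0 then -\<infinity>
         else ereal (1 / (\<alpha> * V) * ln (Z / (V ^ N / fact N))))"

definition entropy_density :: "real \<Rightarrow> (nat \<Rightarrow> nat) \<Rightarrow> nat \<Rightarrow> nat \<Rightarrow> real \<Rightarrow> ereal" where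
  "entropy_density p k m n \<alpha> = Liminf at_top (entropy_term p k m n \<alpha>)"

end

theory Submission
  imports Defs "HOL-Real_Asymp.Real_Asymp"
begin

text \<open>
  Let \<open>\<Delta> = 2\<^sup>n\<close> be the volume of the ball of radius \<open>2r\<^sub>n\<close>. Give packings of size \<open>t\<close> in
  \<open>S = B(0, R)\<close> the weight \<open>\<lambda>\<^sup>t / t!\<close>, allow at most \<open>s\<close> points, and pick a centre \<open>v \<in> S\<close> uniformly. Given
  the points that do not conflict with \<open>v\<close>, those that do form a packing in some \<open>T\<close> inside the ball
  of radius \<open>2r\<^sub>n\<close> around \<open>v\<close>. By uniform convexity of the norm, a pair of points of \<open>T\<close> conflicts only
  with exponentially small weight, so their number \<open>j\<close> has weights close to \<open>x\<^sup>j / j!\<close> with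
  \<open>x = \<lambda> vol T\<close>. Since \<open>(y - x) e\<^sup>x \<le> e\<^bsup>y - 1\<^esup>\<close>, averaging \<open>y - j\<close> bounds the probability that no point
  conflicts with \<open>v\<close> from below in terms of the mean of \<open>j\<close>, which is at most \<open>\<Delta> s / V\<close>. Up to the
  factor \<open>\<lambda>\<close> that probability is the density of points, and for \<open>\<lambda> = 16 e\<^sup>D \<alpha>\<close>, \<open>\<alpha> = D / \<Delta>\<close> and \<open>s\<close>
  slightly above \<open>\<alpha>V\<close> this density would exceed \<open>s / V\<close> unless the top levels \<open>t > \<alpha>V\<close> carry a
  positive fraction of the mass. Hence \<open>\<lambda>\<^sup>t Z(t)\<close> is bounded below for some \<open>t\<close> just above \<open>\<alpha>V\<close>, and
  Stirling's bound gives entropy at least \<open>log (\<alpha> / (e \<lambda>)) \<ge> - D - O(1)\<close>. It remains to take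
  \<open>D = n log (2 / c)\<close> with \<open>c\<close> close enough to \<open>2\<close>.
\<close>

section \<open>A truncated tangent line inequality\<close>

lemma exp_partial_sum_le:
  fixes x :: real assumes "0 \<le> x"
  shows "(\<Sum>i<n. x ^ i / fact i) \<le> exp x"
proof -
  have "(\<lambda>i. x ^ i / fact i) sums exp x"
    using exp_converges[of x] by (simp add: divide_inverse mult.commute)
  then show ?thesis
    using sum_le_suminf[of "\<lambda>i. x ^ i / fact i" "{..<n}"] assms
    by (auto simp: sums_iff)
qed

text \<open>With \<open>x = n\<close> this is the crude Stirling bound
  \<open>n ^ n / exp n \<le> fact n\<close>, the form used below.\<close>

lemma power_div_fact_le_exp:
  fixes x :: real assumes "0 \<le> x"
  shows "x ^ n / fact n \<le> exp x"
proof -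
  have "x ^ n / fact n \<le> (\<Sum>i<Suc n. x ^ i / fact i)"
    by (rule member_le_sum) (use assms in auto)
  also have "\<dots> \<le> exp x" by (rule exp_partial_sum_le[OF assms])
  finally show ?thesis .
qed

text \<open>Since \<open>j * x ^ j / j! = x * (x ^ (j - 1) / (j - 1)!)\<close>, the part with the
  factor \<open>j\<close> is \<open>x\<close> times the same sum with one term fewer, so only a
  boundary term at \<open>n\<close> is left over.\<close>

lemma weighted_exp_sum:
  fixes x y :: real
  shows "(\<Sum>j\<le>n. (y - real j) * (x ^ j / fact j)) =
    (y - x) * (\<Sum>i<n. x ^ i / fact i) + y * (x ^ n / fact n)"
proof (induction n)
  case (Suc n)
  have "real (Suc n) * (x ^ Suc n / fact (Suc n)) = x * (x ^ n / fact n)"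
    by (simp add: fact_Suc del: of_nat_Suc)
  then have eq: "(y - real (Suc n)) * (x ^ Suc n / fact (Suc n)) =
      y * (x ^ Suc n / fact (Suc n)) - x * (x ^ n / fact n)"
    by (simp only: left_diff_distrib)
  show ?case
    unfolding sum.atMost_Suc sum.lessThan_Suc Suc.IH eq
    by (simp only: distrib_left left_diff_distrib)
qed simp

text \<open>Stirling gives \<open>x ^ J / fact J \<le> (3 * x / J) ^ J \<le> (1 / 2) ^ J\<close>,
  because \<open>3 * x \<le> 6 * y \<le> J / 2\<close>; the factor \<open>y \<le> J / 12\<close> is
  absorbed by \<open>J < 2 ^ J\<close>.\<close>

lemma tail_fact_bound:
  fixes x y :: real
  assumes x: "0 \<le> x" "x \<le> 2 * y" and J: "12 * y \<le> real J" and y: "1 \<le> y"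
  shows "y * (x ^ J / fact J) \<le> 1 / 2"
proof -
  have J0: "real J > 0" using J y by linarith
  have "real J ^ J / fact J \<le> exp (real J)" by (rule power_div_fact_le_exp) simp
  also have "exp (real J) = exp 1 ^ J" by (simp add: exp_of_nat_mult[symmetric])
  also have "\<dots> \<le> 3 ^ J" by (intro power_mono) (use exp_le in auto)
  finally have f: "real J ^ J / fact J \<le> 3 ^ J" .
  have "x ^ J / fact J = (x / real J) ^ J * (real J ^ J / fact J)"
    using J0 by (simp add: power_divide)
  also have "\<dots> \<le> (x / real J) ^ J * 3 ^ J"
    using f x by (intro mult_left_mono) auto
  also have "\<dots> = (3 * x / real J) ^ J" by (simp add: power_mult_distrib[symmetric] mult.commute)
  also have "\<dots> \<le> (1 / 2) ^ J"
  proof (rule power_mono)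
    show "3 * x / real J \<le> 1 / 2" using J0 J x by (simp add: field_simps)
  qed (use x in auto)
  finally have "x ^ J / fact J \<le> (1 / 2) ^ J" .
  then have "y * (x ^ J / fact J) \<le> y * (1 / 2) ^ J" using y by (intro mult_left_mono) auto
  also have "\<dots> \<le> (2 ^ J / 12) * (1 / 2) ^ J"
  proof (rule mult_right_mono)
    have "real J < 2 ^ J" by (rule of_nat_less_two_power)
    then show "y \<le> 2 ^ J / 12" using J by linarith
  qed simp
  also have "\<dots> = 1 / 12" by (simp add: power_divide)
  finally show ?thesis by linarith
qed

text \<open>With \<open>z j = x ^ j / j!\<close> and \<open>J = \<infinity>\<close> the left side is \<open>(y - x) * exp x \<le> exp (y - 1)\<close>, a tangent
  line bound that replaces the use of Jensen's inequality; \<open>\<beta>\<close> measures the failure of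
  independence.\<close>
lemma truncated_tangent_bound:
  fixes x y \<beta> :: real and z :: "nat \<Rightarrow> real"
  assumes x: "0 \<le> x" and y: "1 \<le> y" and J: "12 * y \<le> real J"
    and \<beta>: "0 \<le> \<beta>" "\<beta> * real J * (4 * y) * exp (2 * y) \<le> 1"
    and upper: "\<And>j. j \<le> J \<Longrightarrow> z j \<le> x ^ j / fact j"
    and lower: "\<And>j. 2 \<le> j \<Longrightarrow> j \<le> J \<Longrightarrow> x ^ j / fact j - \<beta> * (x ^ (j - 1) / fact (j - 2)) \<le> z j"
  shows "(\<Sum>j\<le>J. (y - real j) * z j) \<le> 2 * exp (y - 1)"
proof -
  define E where "E = (\<Sum>i<J. x ^ i / fact i)"
  \<comment> \<open>\<open>\<beta> * e j\<close> is the defect allowed by \<open>lower\<close>. For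
    \<open>j < 2\<close> it can be 0: then \<open>j \<le> y\<close>, and only \<open>upper\<close>
    is used.\<close>
  define e where "e j = (if 2 \<le> j then x ^ (j - 1) / fact (j - 2) else 0)" for j
  have J0: "real J \<ge> 12" using J y by linarith
  have E0: "0 \<le> E" unfolding E_def using x by (intro sum_nonneg) auto
  have e0: "0 \<le> e j" for j using x by (auto simp: e_def)
  obtain K where K: "J = Suc (Suc K)" using J0 by (cases J; cases "J - 1") auto
  have "(\<Sum>j\<le>J. e j) = (\<Sum>i\<le>K. x * (x ^ i / fact i))"
    unfolding K sum.atMost_Suc_shift by (simp add: e_def)
  also have "\<dots> = x * (\<Sum>i<Suc K. x ^ i / fact i)"
    by (simp add: sum_distrib_left lessThan_Suc_atMost)
  also have "\<dots> \<le> x * E"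
    unfolding E_def K using x by (intro mult_left_mono) simp_all
  finally have esum: "(\<Sum>j\<le>J. e j) \<le> x * E" .
  have "(\<Sum>j\<le>J. (y - real j) * z j) \<le> (\<Sum>j\<le>J. (y - real j) * (x ^ j / fact j) + \<beta> * real J * e j)"
  proof (rule sum_mono)
    fix j assume j: "j \<in> {..J}"
    show "(y - real j) * z j \<le> (y - real j) * (x ^ j / fact j) + \<beta> * real J * e j"
    \<comment> \<open>The sign of \<open>y - j\<close> decides which of the two bounds on
      \<open>z j\<close> applies.\<close>
    proof (cases "real j \<le> y")
      case True
      then have "(y - real j) * z j \<le> (y - real j) * (x ^ j / fact j)"
        using upper[of j] j by (intro mult_left_mono) auto
      moreover have "0 \<le> \<beta> * real J * e j" using \<beta> e0 by simp
      ultimately show ?thesis by linarith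
    next
      case False
      then have "2 \<le> j" using y by linarith
      then have "x ^ j / fact j - \<beta> * e j \<le> z j" using lower[of j] j by (simp add: e_def)
      then have "(real j - y) * (x ^ j / fact j - \<beta> * e j) \<le> (real j - y) * z j"
        using False by (intro mult_left_mono) auto
      moreover have "(real j - y) * (\<beta> * e j) \<le> real J * (\<beta> * e j)"
        using j y \<beta> e0 by (intro mult_right_mono) auto
      moreover have "\<beta> * real J * e j = real J * (\<beta> * e j)" by simp
      ultimately show ?thesis
        unfolding right_diff_distrib left_diff_distrib by linarith
    qed
  qed
  also have "\<dots> = (y - x) * E + y * (x ^ J / fact J) + \<beta> * real J * (\<Sum>j\<le>J. e j)"
    unfolding sum.distrib weighted_exp_sum E_def sum_distrib_left[symmetric] by simp
  also have "\<dots> \<le> (y - x) * E + y * (x ^ J / fact J) + \<beta> * real J * (x * E)"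
    using esum \<beta> by (intro add_left_mono mult_left_mono) auto
  also have "\<dots> \<le> 2 * exp (y - 1)"
  \<comment> \<open>For \<open>x \<le> 2 * y\<close> the main term is at most
    \<open>exp (y - 1)\<close> and the two errors at most \<open>1 / 2\<close> each, where
    \<open>1 \<le> exp (y - 1)\<close>. For larger \<open>x\<close> the main term is at most
    \<open>- x * E / 2\<close> and absorbs both errors, each at most
    \<open>x * E / 4\<close>.\<close>
  proof (cases "x \<le> 2 * y")
    case True
    have Ee: "E \<le> exp x" unfolding E_def by (rule exp_partial_sum_le[OF x])
    have 1: "(y - x) * E \<le> exp (y - 1)"
    proof (cases "x \<le> y")
      case True
      \<comment> \<open>\<open>y - x \<le> exp (y - x - 1)\<close> is the tangent line of the
        exponential at 0; the product with \<open>exp x\<close> no longer depends on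
        \<open>x\<close>.\<close>
      have "(y - x) * E \<le> exp (y - x - 1) * exp x"
        using True Ee E0 exp_ge_add_one_self[of "y - x - 1"] by (intro mult_mono) auto
      also have "\<dots> = exp (y - 1)" by (simp add: exp_add[symmetric])
      finally show ?thesis .
    next
      case False
      then have "(y - x) * E \<le> 0" using E0 by (intro mult_nonpos_nonneg) auto
      then show ?thesis by (smt (verit) exp_gt_zero)
    qed
    have 2: "y * (x ^ J / fact J) \<le> 1 / 2"
      by (rule tail_fact_bound[OF x True J y])
    have "exp x \<le> exp (2 * y)" using True by simp
    with Ee have "E \<le> exp (2 * y)" by linarith
    then have "x * E \<le> (2 * y) * exp (2 * y)"
      using True x y E0 by (intro mult_mono) auto
    then have "\<beta> * real J * (x * E) \<le> \<beta> * real J * ((2 * y) * exp (2 * y))"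
      using \<beta> by (intro mult_left_mono) auto
    also have "\<dots> \<le> 1 / 2" using \<beta>(2) by (simp add: algebra_simps)
    finally have 3: "\<beta> * real J * (x * E) \<le> 1 / 2" .
    have "1 \<le> exp (y - 1)" using y by simp
    with 1 2 3 show ?thesis by linarith
  next
    case False
    \<comment> \<open>The boundary term is compared with the last summand of \<open>E\<close>: their
      ratio is \<open>x / J\<close>, and \<open>y / J\<close> is at most
      \<open>1 / 4\<close>.\<close>
    have "x ^ (J - 1) / fact (J - 1) \<le> E"
      unfolding E_def by (rule member_le_sum) (use x J0 in auto)
    then have "(y / real J * x) * (x ^ (J - 1) / fact (J - 1)) \<le> (y / real J * x) * E"
      using x y J0 by (intro mult_left_mono) auto
    moreover have "y * (x ^ J / fact J) = (y / real J * x) * (x ^ (J - 1) / fact (J - 1))"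
      unfolding K by (simp add: field_simps)
    moreover have "(y / real J * x) * E \<le> (1 / 4) * (x * E)"
      unfolding mult.assoc using J0 J x y E0 by (intro mult_right_mono) (auto simp: field_simps)
    ultimately have 1: "y * (x ^ J / fact J) \<le> (1 / 4) * (x * E)" by linarith
    have "4 * 1 \<le> (4 * y) * exp (2 * y)" using y by (intro mult_mono) auto
    then have "\<beta> * real J * 4 \<le> \<beta> * real J * ((4 * y) * exp (2 * y))"
      using \<beta> by (intro mult_left_mono) auto
    moreover have "\<beta> * real J * ((4 * y) * exp (2 * y)) \<le> 1"
      using \<beta>(2) by (simp only: mult.assoc)
    ultimately have "\<beta> * real J \<le> 1 / 4" by linarith
    then have 2: "\<beta> * real J * (x * E) \<le> (1 / 4) * (x * E)"
      using x E0 by (intro mult_right_mono) auto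
    have "(y - x) * E \<le> (- x / 2) * E" using False E0 by (intro mult_right_mono) auto
    then have "(y - x) * E \<le> - (1 / 2) * (x * E)" by simp
    with 1 2 have "(y - x) * E + y * (x ^ J / fact J) + \<beta> * real J * (x * E) \<le> 0" by linarith
    then show ?thesis by (smt (verit) exp_gt_zero)
  qed
  finally show ?thesis .
qed

section \<open>Weights on a triangular array, summed by levels and by rows\<close>

lemma sum_triangle:
  fixes f :: "nat \<Rightarrow> nat \<Rightarrow> 'b::comm_monoid_add"
  shows "(\<Sum>t\<le>s. \<Sum>j\<le>t. f (t - j) j) = (\<Sum>i\<le>s. \<Sum>j\<le>s - i. f i j)"
proof -
  have "(\<Sum>t\<le>s. \<Sum>j\<le>t. f (t - j) j) = (\<Sum>(j, i)\<in>{(j, i). j + i \<le> s}. f i j)"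
    by (rule sum.triangle_reindex_eq[symmetric])
  also have "\<dots> = (\<Sum>(i, j)\<in>(SIGMA i:{..s}. {..s - i}). f i j)"
    by (rule sum.reindex_bij_witness[of _ "\<lambda>(i, j). (j, i)" "\<lambda>(i, j). (j, i)"]) auto
  also have "\<dots> = (\<Sum>i\<le>s. \<Sum>j\<le>s - i. f i j)"
    by (subst sum.Sigma) auto
  finally show ?thesis .
qed

text \<open>Think of \<open>r i j\<close> as the weight of a centre with \<open>i\<close> points
  away from it and \<open>j\<close> in conflict with it, and of \<open>a t\<close> as the weight of
  packings of \<open>t\<close> points. The sum of \<open>(y - j) * r i j\<close> over
  \<open>i + j \<le> s\<close> is computed twice. By levels \<open>t = i + j\<close>,
  \<open>mass\<close> and \<open>mean\<close> bound it from below. By rows, those with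
  \<open>i \<le> s - J\<close> are long enough for \<open>tangent\<close>, their terms with
  \<open>j > J\<close> being nonpositive; the other rows only meet levels above \<open>s - J\<close>
  and are bounded by their mass.\<close>

lemma top_levels_dominate:
  fixes r :: "nat \<Rightarrow> nat \<Rightarrow> real" and a :: "nat \<Rightarrow> real" and y V \<Delta> lam c :: real
  assumes r0: "\<And>i j. 0 \<le> r i j" and a0: "\<And>t. 0 \<le> a t"
    and pos: "0 \<le> y" "0 \<le> V" "0 \<le> \<Delta>" "0 < lam" "0 \<le> c" and J: "y \<le> real J" "1 \<le> J" "J \<le> s"
    and mass: "\<And>t. (\<Sum>j\<le>t. r (t - j) j) = V * a t"
    and mean: "\<And>t. (\<Sum>j\<le>t. real j * r (t - j) j) \<le> \<Delta> * real t * a t"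
    and free: "\<And>i. r i 0 = real (Suc i) * a (Suc i) / lam"
    and tangent: "\<And>i. (\<Sum>j\<le>J. (y - real j) * r i j) \<le> c * r i 0"
  shows "(y * V - \<Delta> * real s - c * real s / lam) * (\<Sum>t\<le>s. a t) \<le> y * V * (\<Sum>t\<in>{s - J<..s}. a t)"
proof -
  define Z where "Z = (\<Sum>t\<le>s. a t)"
  have "(y * V - \<Delta> * real s) * Z = (\<Sum>t\<le>s. (y * V - \<Delta> * real s) * a t)"
    by (simp add: Z_def sum_distrib_left)
  also have "\<dots> \<le> (\<Sum>t\<le>s. \<Sum>j\<le>t. (y - real j) * r (t - j) j)"
  proof (rule sum_mono)
    fix t assume t: "t \<in> {..s}"
    have "\<Delta> * real t * a t \<le> \<Delta> * real s * a t"
      using t pos a0 by (intro mult_right_mono mult_left_mono) auto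
    then have "(y * V - \<Delta> * real s) * a t \<le> y * (\<Sum>j\<le>t. r (t - j) j) - (\<Sum>j\<le>t. real j * r (t - j) j)"
      using mean[of t] mass[of t] by (simp add: algebra_simps)
    also have "\<dots> = (\<Sum>j\<le>t. (y - real j) * r (t - j) j)"
      by (simp add: left_diff_distrib sum_subtractf sum_distrib_left)
    finally show "(y * V - \<Delta> * real s) * a t \<le> (\<Sum>j\<le>t. (y - real j) * r (t - j) j)" .
  qed
  also have "\<dots> = (\<Sum>i\<le>s. \<Sum>j\<le>s - i. (y - real j) * r i j)" by (rule sum_triangle)
  also have "\<dots> = (\<Sum>i\<in>{..s - J}. \<Sum>j\<le>s - i. (y - real j) * r i j) +
      (\<Sum>i\<in>{s - J<..s}. \<Sum>j\<le>s - i. (y - real j) * r i j)"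
    by (subst sum.union_disjoint[symmetric]) (auto intro!: sum.cong)
  also have "\<dots> \<le> c * real s / lam * Z + y * V * (\<Sum>t\<in>{s - J<..s}. a t)"
  proof (rule add_mono)
    have "(\<Sum>i\<in>{..s - J}. \<Sum>j\<le>s - i. (y - real j) * r i j) \<le>
        (\<Sum>i\<in>{..s - J}. c / lam * (real s * a (Suc i)))"
    proof (rule sum_mono)
      fix i assume i: "i \<in> {..s - J}"
      then have iJ: "J \<le> s - i" using J by auto
      have "(\<Sum>j\<le>s - i. (y - real j) * r i j) =
          (\<Sum>j\<le>J. (y - real j) * r i j) + (\<Sum>j\<in>{J<..s - i}. (y - real j) * r i j)"
        using iJ by (subst sum.union_disjoint[symmetric]) (auto intro!: sum.cong)
      also have "\<dots> \<le> (\<Sum>j\<le>J. (y - real j) * r i j) + 0"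
        using J r0 by (intro add_left_mono sum_nonpos mult_nonpos_nonneg) auto
      also have "\<dots> \<le> c * r i 0" using tangent by simp
      also have "\<dots> = c / lam * (real (Suc i) * a (Suc i))" by (simp add: free)
      also have "\<dots> \<le> c / lam * (real s * a (Suc i))"
        using pos i J a0 by (intro mult_left_mono mult_right_mono) auto
      finally show "(\<Sum>j\<le>s - i. (y - real j) * r i j) \<le> c / lam * (real s * a (Suc i))" .
    qed
    also have "\<dots> = c * real s / lam * (\<Sum>i\<in>{..s - J}. a (Suc i))"
      by (simp add: sum_distrib_left mult.assoc)
    also have "\<dots> \<le> c * real s / lam * Z"
    proof (rule mult_left_mono)
      \<comment> \<open>\<open>1 \<le> J\<close> keeps the shifted index \<open>Suc i\<close> at
        most \<open>s\<close>.\<close>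
      have "(\<Sum>i\<in>{..s - J}. a (Suc i)) = (\<Sum>t\<in>Suc ` {..s - J}. a t)"
        by (subst sum.reindex) auto
      also have "\<dots> \<le> Z"
        unfolding Z_def using J a0 by (intro sum_mono2) auto
      finally show "(\<Sum>i\<in>{..s - J}. a (Suc i)) \<le> Z" .
    qed (use pos in auto)
    finally show "(\<Sum>i\<in>{..s - J}. \<Sum>j\<le>s - i. (y - real j) * r i j) \<le> c * real s / lam * Z" .
  next
    have "(\<Sum>i\<in>{s - J<..s}. \<Sum>j\<le>s - i. (y - real j) * r i j) \<le>
        (\<Sum>i\<in>{s - J<..s}. \<Sum>j\<le>s - i. y * r i j)"
      using r0 by (intro sum_mono mult_right_mono) auto
    also have "\<dots> = (\<Sum>i\<le>s. \<Sum>j\<le>s - i. y * (if s - J < i then r i j else 0))"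
      by (rule sum.mono_neutral_cong_left) auto
    also have "\<dots> = (\<Sum>t\<le>s. \<Sum>j\<le>t. y * (if s - J < t - j then r (t - j) j else 0))"
      by (rule sum_triangle[symmetric])
    \<comment> \<open>\<open>t - j > s - J\<close> forces \<open>t > s - J\<close>, so the lower
      levels contribute 0.\<close>
    also have "\<dots> \<le> (\<Sum>t\<le>s. if s - J < t then y * (V * a t) else 0)"
    proof (rule sum_mono)
      fix t
      show "(\<Sum>j\<le>t. y * (if s - J < t - j then r (t - j) j else 0))
          \<le> (if s - J < t then y * (V * a t) else 0)"
      proof (cases "s - J < t")
        case True
        have "(\<Sum>j\<le>t. y * (if s - J < t - j then r (t - j) j else 0)) \<le> (\<Sum>j\<le>t. y * r (t - j) j)"
          using r0 pos by (intro sum_mono mult_left_mono) auto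
        also have "\<dots> = y * (V * a t)" by (simp add: sum_distrib_left[symmetric] mass)
        finally show ?thesis using True by simp
      next
        case False
        then show ?thesis by (auto intro!: sum_nonpos)
      qed
    qed
    also have "\<dots> = (\<Sum>t\<in>{s - J<..s}. y * (V * a t))"
      by (rule sum.mono_neutral_cong_right) auto
    finally show "(\<Sum>i\<in>{s - J<..s}. \<Sum>j\<le>s - i. (y - real j) * r i j) \<le> y * V * (\<Sum>t\<in>{s - J<..s}. a t)"
      by (simp add: sum_distrib_left mult.assoc)
  qed
  finally show ?thesis by (simp add: Z_def algebra_simps)
qed

lemma nn_integral_weighted_sum:
  fixes f :: "nat \<Rightarrow> ennreal"
  assumes [measurable]: "g \<in> borel_measurable N" "\<And>j. h j \<in> borel_measurable N"
  shows "(\<integral>\<^sup>+x. (\<Sum>j\<le>J. f j * h j x) \<partial>N) = (\<Sum>j\<le>J. f j * (\<integral>\<^sup>+x. h j x \<partial>N))"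
    and "(\<integral>\<^sup>+x. c * g x + (\<Sum>j\<le>J. f j * h j x) \<partial>N) =
      c * (\<integral>\<^sup>+x. g x \<partial>N) + (\<Sum>j\<le>J. f j * (\<integral>\<^sup>+x. h j x \<partial>N))"
  by (simp_all add: nn_integral_add nn_integral_sum nn_integral_cmult)

section \<open>Packings avoiding a symmetric conflict relation\<close>

text \<open>The hard-core model with an abstract conflict relation; geometry enters only later,
  through neighbourhood volumes and \<open>sparse\<close>. Regions are predicates, so that deleting
  the neighbours of a point is a conjunction.\<close>

locale conflict_space = sigma_finite_measure M for M :: "'a measure" +
  fixes C :: "'a \<Rightarrow> 'a \<Rightarrow> bool"
  assumes C_sym: "C x y \<longleftrightarrow> C y x"
    and C_measurable: "Measurable.pred (M \<Otimes>\<^sub>M M) (\<lambda>(x, y). C x y)"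
begin

sublocale product: product_sigma_finite "\<lambda>_::nat. M"
  by (simp add: product_sigma_finite_def sigma_finite_measure_axioms)

lemma sigma_finite_tuples: "sigma_finite_measure (Pi\<^sub>M {..<t::nat} (\<lambda>_. M))"
  by (rule product.sigma_finite) simp

lemma pred_C [measurable (raw)]:
  assumes [measurable]: "f \<in> P \<rightarrow>\<^sub>M M" "g \<in> P \<rightarrow>\<^sub>M M"
  shows "Measurable.pred P (\<lambda>p. C (f p) (g p))"
proof -
  have "(\<lambda>p. (f p, g p)) \<in> P \<rightarrow>\<^sub>M M \<Otimes>\<^sub>M M" by measurable
  from measurable_compose[OF this C_measurable] show ?thesis by simp
qed

definition packing :: "nat \<Rightarrow> ('a \<Rightarrow> bool) \<Rightarrow> (nat \<Rightarrow> 'a) \<Rightarrow> bool" where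
  "packing t A X \<longleftrightarrow> (\<forall>i<t. A (X i)) \<and> (\<forall>i<t. \<forall>j<t. i \<noteq> j \<longrightarrow> \<not> C (X i) (X j))"

text \<open>Ordered tuples are integrated, so this is \<open>t!\<close> times the partition
  function. Values in \<open>ennreal\<close> let Fubini's theorem apply without integrability
  conditions.\<close>

definition pack_vol :: "nat \<Rightarrow> ('a \<Rightarrow> bool) \<Rightarrow> ennreal" where
  "pack_vol t A = (\<integral>\<^sup>+X. of_bool (packing t A X) \<partial>Pi\<^sub>M {..<t} (\<lambda>_. M))"

text \<open>The first \<open>i\<close> points lie in \<open>B\<close>, the last \<open>j\<close> in \<open>D\<close>.\<close>
definition split_vol :: "nat \<Rightarrow> nat \<Rightarrow> ('a \<Rightarrow> bool) \<Rightarrow> ('a \<Rightarrow> bool) \<Rightarrow> ennreal" where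
  "split_vol i j B D = (\<integral>\<^sup>+Y. of_bool (packing i B Y) * pack_vol j (\<lambda>u. D u \<and> (\<forall>k<i. \<not> C (Y k) u))
      \<partial>Pi\<^sub>M {..<i} (\<lambda>_. M))"

section \<open>Measurability\<close>

lemma of_bool_measurable [measurable (raw)]:
  "Measurable.pred P f \<Longrightarrow> (\<lambda>p. of_bool (f p) :: ennreal) \<in> borel_measurable P"
  unfolding of_bool_def by measurable

lemma pred_split: "Measurable.pred (P \<Otimes>\<^sub>M M) (\<lambda>(p, u). F p u) \<Longrightarrow>
    f \<in> K \<rightarrow>\<^sub>M P \<Longrightarrow> g \<in> K \<rightarrow>\<^sub>M M \<Longrightarrow> Measurable.pred K (\<lambda>k. F (f k) (g k))"
  using measurable_compose[of "\<lambda>k. (f k, g k)" K "P \<Otimes>\<^sub>M M" "\<lambda>(p, u). F p u"] by simp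

text \<open>The region \<open>F p\<close> may depend on a parameter, jointly measurably with the
  point: in the recursions the parameter holds the points already fixed.\<close>

lemma packing_measurable:
  assumes F: "Measurable.pred (P \<Otimes>\<^sub>M M) (\<lambda>(p, u). F p u)"
    and f: "f \<in> K \<rightarrow>\<^sub>M P" and g: "\<And>i. i < t \<Longrightarrow> (\<lambda>k. g k i) \<in> K \<rightarrow>\<^sub>M M"
  shows "Measurable.pred K (\<lambda>k. packing t (F (f k)) (g k))"
proof -
  have 1: "Measurable.pred K (\<lambda>k. \<forall>i\<in>{..<t}. F (f k) (g k i))"
    by (rule pred_intros_finite(3)[OF finite_lessThan], rule pred_split[OF F f g]) simp
  have 2: "Measurable.pred K (\<lambda>k. \<not> C (g k i) (g k j))" if "i < t" "j < t" for i j
    using pred_C[OF g[OF that(1)] g[OF that(2)]] by simp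
  have 3: "Measurable.pred K (\<lambda>k. \<forall>i\<in>{..<t}. \<forall>j\<in>{..<t} - {i}. \<not> C (g k i) (g k j))"
    by (intro pred_intros_finite(3) 2) auto
  have "packing t (F (f k)) (g k) \<longleftrightarrow> (\<forall>i\<in>{..<t}. F (f k) (g k i)) \<and>
      (\<forall>i\<in>{..<t}. \<forall>j\<in>{..<t} - {i}. \<not> C (g k i) (g k j))" for k
    by (auto simp: packing_def)
  with 1 3 show ?thesis by simp
qed

lemma pack_vol_measurable:
  assumes F: "Measurable.pred (P \<Otimes>\<^sub>M M) (\<lambda>(p, u). F p u)"
  shows "(\<lambda>p. pack_vol t (F p)) \<in> borel_measurable P"
proof -
  interpret T: sigma_finite_measure "Pi\<^sub>M {..<t} (\<lambda>_. M)" by (rule sigma_finite_tuples)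
  have "(\<lambda>(p, X). of_bool (packing t (F p) X) :: ennreal)
      \<in> borel_measurable (P \<Otimes>\<^sub>M Pi\<^sub>M {..<t} (\<lambda>_. M))"
    unfolding split_beta
    by (intro of_bool_measurable packing_measurable[OF F])
      (auto intro!: measurable_compose[OF measurable_snd] measurable_component_singleton)
  then show ?thesis unfolding pack_vol_def by (rule T.borel_measurable_nn_integral)
qed

lemma free_measurable:
  assumes "Measurable.pred K D" "h \<in> K \<rightarrow>\<^sub>M M" "\<And>k. k < i \<Longrightarrow> (\<lambda>z. Y z k) \<in> K \<rightarrow>\<^sub>M M"
  shows "Measurable.pred K (\<lambda>z. D z \<and> (\<forall>k<(i::nat). \<not> C (Y z k) (h z)))"
proof -
  have "Measurable.pred K (\<lambda>z. D z \<and> (\<forall>k\<in>{..<i}. \<not> C (Y z k) (h z)))"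
    using assms by (intro pred_intros_logic pred_intros_finite finite_lessThan) auto
  then show ?thesis by (simp add: Ball_def)
qed

lemma split_vol_integrand_measurable:
  assumes F: "Measurable.pred (P \<Otimes>\<^sub>M M) (\<lambda>(p, u). F p u)"
    and G: "Measurable.pred (P \<Otimes>\<^sub>M M) (\<lambda>(p, u). G p u)"
  shows "(\<lambda>(p, Y). of_bool (packing i (F p) Y) * pack_vol j (\<lambda>u. G p u \<and> (\<forall>k<i. \<not> C (Y k) u)))
      \<in> borel_measurable (P \<Otimes>\<^sub>M Pi\<^sub>M {..<i} (\<lambda>_. M))"
  unfolding split_beta
proof (intro borel_measurable_times_ennreal of_bool_measurable packing_measurable[OF F]
    pack_vol_measurable)
  show "Measurable.pred ((P \<Otimes>\<^sub>M Pi\<^sub>M {..<i} (\<lambda>_. M)) \<Otimes>\<^sub>M M)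
      (\<lambda>(z, u). G (fst z) u \<and> (\<forall>k<i. \<not> C (snd z k) u))"
    unfolding split_beta
    by (intro free_measurable pred_split[OF G])
      (auto intro!: measurable_compose[OF measurable_snd] measurable_compose[OF measurable_fst]
        measurable_component_singleton)
qed (auto intro!: measurable_compose[OF measurable_snd] measurable_component_singleton)

lemma split_vol_measurable:
  assumes F: "Measurable.pred (P \<Otimes>\<^sub>M M) (\<lambda>(p, u). F p u)"
    and G: "Measurable.pred (P \<Otimes>\<^sub>M M) (\<lambda>(p, u). G p u)"
  shows "(\<lambda>p. split_vol i j (F p) (G p)) \<in> borel_measurable P"
proof -
  interpret T: sigma_finite_measure "Pi\<^sub>M {..<i} (\<lambda>_. M)" by (rule sigma_finite_tuples)
  from T.borel_measurable_nn_integral[OF split_vol_integrand_measurable[OF F G]]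
  show ?thesis unfolding split_vol_def by simp
qed

lemma pred_const_param: "Measurable.pred M A \<Longrightarrow> Measurable.pred (P \<Otimes>\<^sub>M M) (\<lambda>(p, u). A u)"
  unfolding split_beta by (rule measurable_compose[OF measurable_snd])

section \<open>Recursions obtained by fixing one point\<close>

lemma pack_vol_0 [simp]: "pack_vol 0 A = 1"
  by (simp add: pack_vol_def packing_def space_PiM_empty emeasure_PiM_empty)

lemma split_vol_0 [simp]: "split_vol 0 j B D = pack_vol j D"
  by (simp add: split_vol_def packing_def space_PiM_empty emeasure_PiM_empty)

text \<open>Fixing the last point turns its constraints on the others into a smaller region, so the
  recursions stay within one family of volumes.\<close>

lemma packing_upd: "packing (Suc t) A (X(t := x)) \<longleftrightarrow> A x \<and> packing t (\<lambda>u. A u \<and> \<not> C x u) X"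
  by (auto simp: packing_def less_Suc_eq all_conj_distrib C_sym[of x])

lemma nn_integral_tuple_Suc:
  assumes "f \<in> borel_measurable (Pi\<^sub>M {..<Suc t} (\<lambda>_. M))"
  shows "(\<integral>\<^sup>+X. f X \<partial>Pi\<^sub>M {..<Suc t} (\<lambda>_. M)) =
    (\<integral>\<^sup>+x. (\<integral>\<^sup>+X. f (X(t := x)) \<partial>Pi\<^sub>M {..<t} (\<lambda>_. M)) \<partial>M)"
  using product.product_nn_integral_insert_rev[of "{..<t}" t f] assms
  by (simp add: lessThan_Suc)

lemma pack_vol_Suc:
  assumes A: "Measurable.pred M A"
  shows "pack_vol (Suc t) A = (\<integral>\<^sup>+x. of_bool (A x) * pack_vol t (\<lambda>u. A u \<and> \<not> C x u) \<partial>M)"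
proof -
  \<comment> \<open>A constant map into \<open>count_space UNIV\<close> serves as a dummy parameter,
    since the region is fixed here.\<close>
  have "Measurable.pred (Pi\<^sub>M {..<Suc t} (\<lambda>_. M)) (packing (Suc t) A)"
    by (rule packing_measurable[OF pred_const_param[OF A], where f = "\<lambda>_. undefined"
          and P = "count_space UNIV"]) simp_all
  then have "pack_vol (Suc t) A = (\<integral>\<^sup>+x. (\<integral>\<^sup>+X. of_bool (packing (Suc t) A (X(t := x)))
      \<partial>Pi\<^sub>M {..<t} (\<lambda>_. M)) \<partial>M)"
    unfolding pack_vol_def by (intro nn_integral_tuple_Suc of_bool_measurable)
  also have "\<dots> = (\<integral>\<^sup>+x. of_bool (A x) * pack_vol t (\<lambda>u. A u \<and> \<not> C x u) \<partial>M)"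
  proof (rule nn_integral_cong)
    fix x
    show "(\<integral>\<^sup>+X. of_bool (packing (Suc t) A (X(t := x))) \<partial>Pi\<^sub>M {..<t} (\<lambda>_. M)) =
        of_bool (A x) * pack_vol t (\<lambda>u. A u \<and> \<not> C x u)"
      unfolding packing_upd pack_vol_def by (cases "A x") simp_all
  qed
  finally show ?thesis .
qed

lemma split_vol_Suc:
  assumes B: "Measurable.pred M B" and D: "Measurable.pred M D"
  shows "split_vol (Suc i) j B D =
    (\<integral>\<^sup>+x. of_bool (B x) * split_vol i j (\<lambda>u. B u \<and> \<not> C x u) (\<lambda>u. D u \<and> \<not> C x u) \<partial>M)"
proof -
  let ?f = "\<lambda>Y. of_bool (packing (Suc i) B Y) * pack_vol j (\<lambda>u. D u \<and> (\<forall>k<Suc i. \<not> C (Y k) u))"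
  have "?f \<in> borel_measurable (Pi\<^sub>M {..<Suc i} (\<lambda>_. M))"
    using measurable_compose[OF measurable_Pair1' split_vol_integrand_measurable[where P = "count_space UNIV"
      and F = "\<lambda>_. B" and G = "\<lambda>_. D", OF pred_const_param[OF B] pred_const_param[OF D]],
      of undefined "Suc i"] by simp
  then have "split_vol (Suc i) j B D = (\<integral>\<^sup>+x. (\<integral>\<^sup>+Y. ?f (Y(i := x)) \<partial>Pi\<^sub>M {..<i} (\<lambda>_. M)) \<partial>M)"
    unfolding split_vol_def by (rule nn_integral_tuple_Suc)
  also have "\<dots> = (\<integral>\<^sup>+x. (\<integral>\<^sup>+Y. of_bool (B x) * (of_bool (packing i (\<lambda>u. B u \<and> \<not> C x u) Y) *
      pack_vol j (\<lambda>u. (D u \<and> \<not> C x u) \<and> (\<forall>k<i. \<not> C (Y k) u))) \<partial>Pi\<^sub>M {..<i} (\<lambda>_. M)) \<partial>M)"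
  proof (intro nn_integral_cong)
    fix x Y
    have "(\<lambda>u. D u \<and> (\<forall>k<Suc i. \<not> C ((Y(i := x)) k) u)) =
        (\<lambda>u. (D u \<and> \<not> C x u) \<and> (\<forall>k<i. \<not> C (Y k) u))"
      by (auto simp: less_Suc_eq)
    then show "?f (Y(i := x)) = of_bool (B x) * (of_bool (packing i (\<lambda>u. B u \<and> \<not> C x u) Y) *
      pack_vol j (\<lambda>u. (D u \<and> \<not> C x u) \<and> (\<forall>k<i. \<not> C (Y k) u)))"
      by (simp add: packing_upd)
  qed
  also have "\<dots> = (\<integral>\<^sup>+x. of_bool (B x) * split_vol i j (\<lambda>u. B u \<and> \<not> C x u) (\<lambda>u. D u \<and> \<not> C x u) \<partial>M)"
  proof (rule nn_integral_cong)
    fix x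
    show "(\<integral>\<^sup>+Y. of_bool (B x) * (of_bool (packing i (\<lambda>u. B u \<and> \<not> C x u) Y) *
        pack_vol j (\<lambda>u. (D u \<and> \<not> C x u) \<and> (\<forall>k<i. \<not> C (Y k) u))) \<partial>Pi\<^sub>M {..<i} (\<lambda>_. M)) =
        of_bool (B x) * split_vol i j (\<lambda>u. B u \<and> \<not> C x u) (\<lambda>u. D u \<and> \<not> C x u)"
      unfolding split_vol_def by (cases "B x") simp_all
  qed
  finally show ?thesis .
qed

text \<open>In the definition the points in \<open>D\<close> are integrated innermost. Induction on
  \<open>i\<close> moves one of them outside, past each point in \<open>B\<close>, by Fubini's
  theorem; symmetry of \<open>C\<close> then restores the form of the recursion.\<close>

lemma split_vol_Suc_right:
  assumes B: "Measurable.pred M B" and D: "Measurable.pred M D"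
  shows "split_vol i (Suc j) B D =
    (\<integral>\<^sup>+x. of_bool (D x) * split_vol i j (\<lambda>u. B u \<and> \<not> C x u) (\<lambda>u. D u \<and> \<not> C x u) \<partial>M)"
  using B D
proof (induction i arbitrary: B D)
  case 0
  then show ?case by (simp add: pack_vol_Suc)
next
  case (Suc i)
  note [measurable] = Suc.prems
  let ?B = "\<lambda>z u. (B u \<and> \<not> C (fst z) u) \<and> \<not> C (snd z) u"
  let ?D = "\<lambda>z u. (D u \<and> \<not> C (fst z) u) \<and> \<not> C (snd z) u"
  have meas: "(\<lambda>z. split_vol i j (?B z) (?D z)) \<in> borel_measurable (M \<Otimes>\<^sub>M M)"
    by (rule split_vol_measurable; measurable)
  have [measurable]: "(\<lambda>z. split_vol i j (\<lambda>u. (B u \<and> \<not> C (snd z) u) \<and> \<not> C (fst z) u)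
      (\<lambda>u. (D u \<and> \<not> C (snd z) u) \<and> \<not> C (fst z) u)) \<in> borel_measurable (M \<Otimes>\<^sub>M M)"
    by (rule split_vol_measurable; measurable)
  interpret pair_sigma_finite M M ..
  have "split_vol (Suc i) (Suc j) B D = (\<integral>\<^sup>+x. of_bool (B x) *
      (\<integral>\<^sup>+y. of_bool (D y \<and> \<not> C x y) * split_vol i j (?B (x, y)) (?D (x, y)) \<partial>M) \<partial>M)"
    by (subst split_vol_Suc) (auto intro!: nn_integral_cong simp: Suc.IH)
  also have "\<dots> = (\<integral>\<^sup>+x. (\<integral>\<^sup>+y. of_bool (B x) * of_bool (D y) * of_bool (\<not> C x y) *
       split_vol i j (?B (x, y)) (?D (x, y)) \<partial>M) \<partial>M)"
    by (intro nn_integral_cong) (auto simp: of_bool_def intro!: nn_integral_cong)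
  also have "\<dots> = (\<integral>\<^sup>+y. (\<integral>\<^sup>+x. of_bool (B x) * of_bool (D y) * of_bool (\<not> C x y) *
       split_vol i j (?B (x, y)) (?D (x, y)) \<partial>M) \<partial>M)"
    by (rule Fubini') (simp only: split_beta fst_conv snd_conv, measurable)
  also have "\<dots> = (\<integral>\<^sup>+y. of_bool (D y) * (\<integral>\<^sup>+x. of_bool (B x \<and> \<not> C y x) *
       split_vol i j (?B (y, x)) (?D (y, x)) \<partial>M) \<partial>M)"
  proof (intro nn_integral_cong)
    fix y
    have e: "split_vol i j (?B (x, y)) (?D (x, y)) = split_vol i j (?B (y, x)) (?D (y, x))" for x
      by (rule arg_cong2[where f = "split_vol i j"]) auto
    show "(\<integral>\<^sup>+x. of_bool (B x) * of_bool (D y) * of_bool (\<not> C x y) * split_vol i j (?B (x, y)) (?D (x, y)) \<partial>M)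
      = of_bool (D y) * (\<integral>\<^sup>+x. of_bool (B x \<and> \<not> C y x) * split_vol i j (?B (y, x)) (?D (y, x)) \<partial>M)"
      unfolding e by (auto simp: of_bool_def C_sym[of _ y] intro!: nn_integral_cong)
  qed
  also have "\<dots> = (\<integral>\<^sup>+y. of_bool (D y) * split_vol (Suc i) j (\<lambda>u. B u \<and> \<not> C y u) (\<lambda>u. D u \<and> \<not> C y u) \<partial>M)"
    by (intro nn_integral_cong) (auto simp: split_vol_Suc)
  finally show ?case .
qed

text \<open>The binomial coefficient counts the positions of the points in \<open>D\<close>. In the
  induction the fixed point lies in \<open>B\<close> or in \<open>D\<close>, and the two resulting
  sums combine by Pascal's rule.\<close>

lemma pack_vol_split:
  assumes B: "Measurable.pred M B" and D: "Measurable.pred M D" and disj: "\<And>x. \<not> (B x \<and> D x)"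
  shows "pack_vol t (\<lambda>u. B u \<or> D u) = (\<Sum>j\<le>t. of_nat (t choose j) * split_vol (t - j) j B D)"
  using assms
proof (induction t arbitrary: B D)
  case 0
  then show ?case by simp
next
  case (Suc t)
  note [measurable] = Suc.prems(1,2)
  let ?B = "\<lambda>x u. B u \<and> \<not> C x u" let ?D = "\<lambda>x u. D u \<and> \<not> C x u"
  have meas[measurable]: "(\<lambda>x. split_vol i j (?B x) (?D x)) \<in> borel_measurable M" for i j
    by (rule split_vol_measurable; measurable)
  have "pack_vol (Suc t) (\<lambda>u. B u \<or> D u) = (\<integral>\<^sup>+x. of_bool (B x \<or> D x) *
      pack_vol t (\<lambda>u. ?B x u \<or> ?D x u) \<partial>M)"
    by (subst pack_vol_Suc) (auto intro!: nn_integral_cong arg_cong[where f = "pack_vol t"] simp: of_bool_def)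
  also have "\<dots> = (\<integral>\<^sup>+x. (\<Sum>j\<le>t. of_nat (t choose j) * (of_bool (B x) * split_vol (t - j) j (?B x) (?D x)))
      + (\<Sum>j\<le>t. of_nat (t choose j) * (of_bool (D x) * split_vol (t - j) j (?B x) (?D x))) \<partial>M)"
  proof (intro nn_integral_cong)
    fix x assume [measurable]: "x \<in> space M"
    have "pack_vol t (\<lambda>u. ?B x u \<or> ?D x u) = (\<Sum>j\<le>t. of_nat (t choose j) * split_vol (t - j) j (?B x) (?D x))"
      by (rule Suc.IH) (use Suc.prems(3) in \<open>measurable, auto\<close>)
    then show "of_bool (B x \<or> D x) * pack_vol t (\<lambda>u. ?B x u \<or> ?D x u) =
      (\<Sum>j\<le>t. of_nat (t choose j) * (of_bool (B x) * split_vol (t - j) j (?B x) (?D x)))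
      + (\<Sum>j\<le>t. of_nat (t choose j) * (of_bool (D x) * split_vol (t - j) j (?B x) (?D x)))"
      using Suc.prems(3)[of x] by (cases "B x"; cases "D x") (simp_all)
  qed
  also have "\<dots> = (\<Sum>j\<le>t. of_nat (t choose j) * split_vol (Suc t - j) j B D)
      + (\<Sum>j\<le>t. of_nat (t choose j) * split_vol (t - j) (Suc j) B D)"
    by (subst nn_integral_add; (subst nn_integral_sum)?; (subst nn_integral_sum)?)
      (auto simp: nn_integral_cmult split_vol_Suc split_vol_Suc_right Suc_diff_le intro!: sum.cong)
  also have "\<dots> = (\<Sum>j\<le>Suc t. of_nat (Suc t choose j) * split_vol (Suc t - j) j B D)"
  proof -
    have 1: "(\<Sum>j\<le>t. of_nat (t choose j) * split_vol (Suc t - j) j B D) =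
        split_vol (Suc t) 0 B D + (\<Sum>j\<le>t. of_nat (t choose Suc j) * split_vol (t - j) (Suc j) B D)"
      using sum.atMost_Suc[of "\<lambda>j. of_nat (t choose j) * split_vol (Suc t - j) j B D" t]
        sum.atMost_Suc_shift[of "\<lambda>j. of_nat (t choose j) * split_vol (Suc t - j) j B D" t]
      by (simp add: binomial_eq_0)
    have 2: "(\<Sum>j\<le>Suc t. of_nat (Suc t choose j) * split_vol (Suc t - j) j B D) =
        split_vol (Suc t) 0 B D + (\<Sum>j\<le>t. (of_nat (t choose j) + of_nat (t choose Suc j)) * split_vol (t - j) (Suc j) B D)"
      by (subst sum.atMost_Suc_shift) simp
    show ?thesis
      unfolding 1 2 distrib_right sum.distrib by (simp only: ac_simps)
  qed
  finally show ?case .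
qed

section \<open>Volumes and the measure of conflicting pairs\<close>

definition vol :: "('a \<Rightarrow> bool) \<Rightarrow> ennreal" where
  "vol A = emeasure M {x \<in> space M. A x}"

text \<open>The measure of ordered conflicting pairs in \<open>A\<close>, the analogue of twice the
  number of edges of a graph.\<close>

definition deg :: "('a \<Rightarrow> bool) \<Rightarrow> ennreal" where
  "deg A = (\<integral>\<^sup>+x. of_bool (A x) * vol (\<lambda>u. A u \<and> C x u) \<partial>M)"

lemma nn_integral_of_bool:
  assumes "Measurable.pred M A"
  shows "(\<integral>\<^sup>+x. of_bool (A x) \<partial>M) = vol A"
proof -
  have "(\<integral>\<^sup>+x. of_bool (A x) \<partial>M) = (\<integral>\<^sup>+x. indicator {x \<in> space M. A x} x \<partial>M)"
    by (intro nn_integral_cong) (auto simp: indicator_def)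
  then show ?thesis using assms by (simp add: vol_def pred_def)
qed

lemma vol_measurable:
  assumes F: "Measurable.pred (P \<Otimes>\<^sub>M M) (\<lambda>(p, u). F p u)"
  shows "(\<lambda>p. vol (F p)) \<in> borel_measurable P"
proof -
  have "(\<lambda>p. \<integral>\<^sup>+u. of_bool (F p u) \<partial>M) \<in> borel_measurable P"
    by (rule borel_measurable_nn_integral) (use of_bool_measurable[OF F] in \<open>simp add: split_beta\<close>)
  moreover have "vol (F p) = (\<integral>\<^sup>+u. of_bool (F p u) \<partial>M)" if "p \<in> space P" for p
    using measurable_compose[OF measurable_Pair1'[OF that] F] by (simp add: nn_integral_of_bool)
  ultimately show ?thesis by (simp cong: measurable_cong)
qed

lemma vol_mono: "(\<And>x. A x \<Longrightarrow> A' x) \<Longrightarrow> Measurable.pred M A' \<Longrightarrow> vol A \<le> vol A'"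
  unfolding vol_def by (intro emeasure_mono) (auto simp: pred_def)

lemma vol_split:
  assumes [measurable]: "Measurable.pred M A" "Measurable.pred M B"
  shows "vol A = vol (\<lambda>u. A u \<and> \<not> B u) + vol (\<lambda>u. A u \<and> B u)"
  unfolding vol_def by (subst plus_emeasure) (auto intro!: arg_cong[where f = "emeasure M"])

lemma pack_vol_mono: "(\<And>u. A u \<Longrightarrow> A' u) \<Longrightarrow> pack_vol t A \<le> pack_vol t A'"
  unfolding pack_vol_def by (intro nn_integral_mono) (auto simp: packing_def)

lemma pack_vol_Suc_le:
  assumes A [measurable]: "Measurable.pred M A"
  shows "pack_vol (Suc t) A \<le> vol A * pack_vol t A"
proof -
  have "pack_vol (Suc t) A \<le> (\<integral>\<^sup>+x. of_bool (A x) * pack_vol t A \<partial>M)"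
    unfolding pack_vol_Suc[OF A] by (intro nn_integral_mono mult_left_mono pack_vol_mono) auto
  also have "\<dots> = vol A * pack_vol t A"
    by (simp add: nn_integral_multc nn_integral_of_bool)
  finally show ?thesis .
qed

lemma pack_vol_le_power:
  assumes A: "Measurable.pred M A"
  shows "pack_vol t A \<le> vol A ^ t"
proof (induction t)
  case (Suc t)
  have "pack_vol (Suc t) A \<le> vol A * pack_vol t A" by (rule pack_vol_Suc_le[OF A])
  also have "\<dots> \<le> vol A * vol A ^ t" using Suc by (intro mult_left_mono) auto
  finally show ?case by simp
qed simp

lemma deg_mono:
  assumes "\<And>x. A x \<Longrightarrow> A' x" and [measurable]: "Measurable.pred M A'"
  shows "deg A \<le> deg A'"
  unfolding deg_def
proof (rule nn_integral_mono)
  fix x assume [measurable]: "x \<in> space M"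
  show "of_bool (A x) * vol (\<lambda>u. A u \<and> C x u) \<le> of_bool (A' x) * vol (\<lambda>u. A' u \<and> C x u)"
    by (rule mult_mono) (auto simp: assms(1) intro!: vol_mono)
qed

text \<open>A further point fails only if it conflicts with one of the \<open>t\<close> others. Each
  such pair costs at most \<open>deg A\<close>, and the remaining \<open>t - 1\<close> points at
  most \<open>vol A ^ (t - 1)\<close>. The induction fixes one point \<open>x\<close>: conflicts
  with the others are covered by the hypothesis for the region without the neighbours of
  \<open>x\<close>, and conflicts with \<open>x\<close> integrate to one more
  \<open>deg A\<close>.\<close>

lemma pack_vol_Suc_ge:
  assumes "Measurable.pred M A"
  shows "vol A * pack_vol t A \<le> pack_vol (Suc t) A + of_nat t * (deg A * vol A ^ (t - 1))"
  using assms
proof (induction t arbitrary: A)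
  case 0
  then show ?case by (simp add: pack_vol_Suc nn_integral_of_bool)
next
  case (Suc t)
  note A [measurable] = Suc.prems
  let ?A = "\<lambda>x u. A u \<and> \<not> C x u"
  let ?e = "of_nat t * (deg A * vol A ^ (t - 1))"
  have [measurable]: "(\<lambda>x. pack_vol t (?A x)) \<in> borel_measurable M" "(\<lambda>x. pack_vol (Suc t) (?A x)) \<in> borel_measurable M"
    by (intro pack_vol_measurable; measurable)+
  have [measurable]: "(\<lambda>x. vol (\<lambda>u. A u \<and> C x u)) \<in> borel_measurable M"
    by (rule vol_measurable; measurable)
  have "vol A * pack_vol (Suc t) A = (\<integral>\<^sup>+x. of_bool (A x) * (vol A * pack_vol t (?A x)) \<partial>M)"
    unfolding pack_vol_Suc[OF A] by (subst nn_integral_cmult[symmetric]) (auto simp: mult.left_commute)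
  also have "\<dots> \<le> (\<integral>\<^sup>+x. of_bool (A x) * pack_vol (Suc t) (?A x) + of_bool (A x) * ?e
      + (of_bool (A x) * vol (\<lambda>u. A u \<and> C x u)) * vol A ^ t \<partial>M)"
  proof (rule nn_integral_mono)
    fix x assume [measurable]: "x \<in> space M"
    have "vol A * pack_vol t (?A x) = vol (?A x) * pack_vol t (?A x) + vol (\<lambda>u. A u \<and> C x u) * pack_vol t (?A x)"
      by (subst vol_split[of A "C x"]) (auto simp: distrib_right)
    also have "\<dots> \<le> (pack_vol (Suc t) (?A x) + of_nat t * (deg (?A x) * vol (?A x) ^ (t - 1)))
        + vol (\<lambda>u. A u \<and> C x u) * vol (?A x) ^ t"
      by (intro add_mono mult_left_mono Suc.IH pack_vol_le_power) auto
    also have "\<dots> \<le> (pack_vol (Suc t) (?A x) + ?e) + vol (\<lambda>u. A u \<and> C x u) * vol A ^ t"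
      by (intro add_mono mult_left_mono mult_mono deg_mono power_mono vol_mono order_refl) auto
    finally show "of_bool (A x) * (vol A * pack_vol t (?A x)) \<le> of_bool (A x) * pack_vol (Suc t) (?A x) + of_bool (A x) * ?e
      + (of_bool (A x) * vol (\<lambda>u. A u \<and> C x u)) * vol A ^ t"
      by (cases "A x") auto
  qed
  also have "\<dots> = pack_vol (Suc (Suc t)) A + vol A * ?e + deg A * vol A ^ t"
    by (simp add: nn_integral_add nn_integral_multc nn_integral_of_bool pack_vol_Suc[OF A, of "Suc t"] deg_def)
  \<comment> \<open>For \<open>t = 0\<close> the truncated exponent \<open>t - 1\<close> is
    harmless, as both sides vanish.\<close>
  also have "vol A * ?e = of_nat t * (deg A * vol A ^ t)"
    by (cases t) (auto simp: mult_ac)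
  finally show ?case by (simp add: distrib_right distrib_left ac_simps)
qed

section \<open>Packings seen from a random centre\<close>

lemma pack_vol_split_remove:
  assumes [measurable]: "Measurable.pred M S" "v \<in> space M"
  shows "pack_vol t S = (\<Sum>j\<le>t. of_nat (t choose j) * split_vol (t - j) j (\<lambda>u. S u \<and> \<not> C v u) (\<lambda>u. S u \<and> C v u))"
proof -
  have "S = (\<lambda>u. (S u \<and> \<not> C v u) \<or> (S u \<and> C v u))" by auto
  then show ?thesis
    using pack_vol_split[of "\<lambda>u. S u \<and> \<not> C v u" "\<lambda>u. S u \<and> C v u" t] by simp
qed

text \<open>One of the \<open>j\<close> points in \<open>D\<close> is marked, with
  \<open>j * (Suc t choose j) = Suc t * (t choose (j - 1))\<close> for \<open>j > 0\<close>. The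
  other \<open>t\<close> points recombine by \<open>pack_vol_split\<close> into a packing that only
  has to avoid the neighbours of the marked point.\<close>

lemma split_vol_mean:
  assumes B [measurable]: "Measurable.pred M B" and D [measurable]: "Measurable.pred M D"
    and disj: "\<And>x. \<not> (B x \<and> D x)"
  shows "(\<Sum>j\<le>Suc t. of_nat j * (of_nat (Suc t choose j) * split_vol (Suc t - j) j B D)) =
    of_nat (Suc t) * (\<integral>\<^sup>+x. of_bool (D x) * pack_vol t (\<lambda>u. (B u \<or> D u) \<and> \<not> C x u) \<partial>M)"
proof -
  let ?B = "\<lambda>x u. B u \<and> \<not> C x u" let ?D = "\<lambda>x u. D u \<and> \<not> C x u"
  have [measurable]: "(\<lambda>x. split_vol i j (?B x) (?D x)) \<in> borel_measurable M" for i j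
    by (rule split_vol_measurable; measurable)
  have "(\<Sum>j\<le>Suc t. of_nat j * (of_nat (Suc t choose j) * split_vol (Suc t - j) j B D)) =
      (\<Sum>j\<le>t. of_nat (Suc j * (Suc t choose Suc j)) * split_vol (t - j) (Suc j) B D)"
    unfolding sum.atMost_Suc_shift of_nat_mult by (simp add: mult.assoc del: binomial_Suc_Suc of_nat_Suc)
  also have "\<dots> = of_nat (Suc t) * (\<Sum>j\<le>t. of_nat (t choose j) * split_vol (t - j) (Suc j) B D)"
    unfolding Suc_times_binomial sum_distrib_left of_nat_mult mult.assoc ..
  also have "(\<Sum>j\<le>t. of_nat (t choose j) * split_vol (t - j) (Suc j) B D) =
      (\<integral>\<^sup>+x. (\<Sum>j\<le>t. of_nat (t choose j) * (of_bool (D x) * split_vol (t - j) j (?B x) (?D x))) \<partial>M)"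
    by (subst nn_integral_sum) (auto simp: nn_integral_cmult split_vol_Suc_right intro!: sum.cong)
  also have "\<dots> = (\<integral>\<^sup>+x. of_bool (D x) * pack_vol t (\<lambda>u. (B u \<or> D u) \<and> \<not> C x u) \<partial>M)"
  proof (rule nn_integral_cong)
    fix x assume [measurable]: "x \<in> space M"
    have "(\<lambda>u. (B u \<or> D u) \<and> \<not> C x u) = (\<lambda>u. ?B x u \<or> ?D x u)" by auto
    moreover have "pack_vol t (\<lambda>u. ?B x u \<or> ?D x u) = (\<Sum>j\<le>t. of_nat (t choose j) * split_vol (t - j) j (?B x) (?D x))"
      by (rule pack_vol_split; (use disj in blast | measurable))
    ultimately show "(\<Sum>j\<le>t. of_nat (t choose j) * (of_bool (D x) * split_vol (t - j) j (?B x) (?D x))) =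
        of_bool (D x) * pack_vol t (\<lambda>u. (B u \<or> D u) \<and> \<not> C x u)"
      by (simp add: sum_distrib_left mult.left_commute)
  qed
  finally show ?thesis .
qed

text \<open>Exactly the last \<open>j\<close> of the \<open>i + j\<close> points conflict with the centre \<open>v\<close>.\<close>
definition centre_vol :: "('a \<Rightarrow> bool) \<Rightarrow> nat \<Rightarrow> nat \<Rightarrow> ennreal" where
  "centre_vol S i j = (\<integral>\<^sup>+v. of_bool (S v) * split_vol i j (\<lambda>u. S u \<and> \<not> C v u) (\<lambda>u. S u \<and> C v u) \<partial>M)"

lemma centre_vol_integrand_measurable:
  assumes [measurable]: "Measurable.pred M S"
  shows "(\<lambda>v. split_vol i j (\<lambda>u. S u \<and> \<not> C v u) (\<lambda>u. S u \<and> C v u)) \<in> borel_measurable M"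
  by (rule split_vol_measurable; measurable)

lemma centre_vol_mass:
  assumes S [measurable]: "Measurable.pred M S"
  shows "(\<Sum>j\<le>t. of_nat (t choose j) * centre_vol S (t - j) j) = vol S * pack_vol t S"
proof -
  note [measurable] = centre_vol_integrand_measurable[OF S]
  have "(\<Sum>j\<le>t. of_nat (t choose j) * centre_vol S (t - j) j) = (\<integral>\<^sup>+v. of_bool (S v) * pack_vol t S \<partial>M)"
    unfolding centre_vol_def
    by (simp add: nn_integral_cmult[symmetric] nn_integral_sum[symmetric] pack_vol_split_remove[OF S]
        sum_distrib_left mult.left_commute cong: nn_integral_cong)
  then show ?thesis by (simp add: nn_integral_multc nn_integral_of_bool)
qed

lemma split_vol_zero_right: "split_vol i 0 B D = pack_vol i B"
  unfolding split_vol_def pack_vol_0 mult_1_right unfolding pack_vol_def ..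

text \<open>A centre in conflict with no point is one more point of the packing; this turns the
  weight of free centres into a density of points.\<close>

lemma centre_vol_free:
  assumes S: "Measurable.pred M S"
  shows "centre_vol S i 0 = pack_vol (Suc i) S"
  unfolding centre_vol_def pack_vol_Suc[OF S] by (simp add: split_vol_zero_right)

text \<open>Mark a point \<open>x\<close> in conflict with the centre \<open>v\<close>. The
  remaining packing depends on \<open>x\<close> but not on \<open>v\<close>, so after Fubini the
  integral over \<open>v\<close> is a neighbourhood volume of \<open>x\<close>, at most
  \<open>\<Delta>\<close>.\<close>

lemma centre_vol_mean:
  assumes S [measurable]: "Measurable.pred M S"
    and D: "\<And>x. x \<in> space M \<Longrightarrow> vol (\<lambda>u. S u \<and> C x u) \<le> \<Delta>"
  shows "(\<Sum>j\<le>t. of_nat j * (of_nat (t choose j) * centre_vol S (t - j) j)) \<le> of_nat t * (\<Delta> * pack_vol t S)"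
proof (cases t)
  case (Suc n)
  note [measurable] = centre_vol_integrand_measurable[OF S]
  have pack_vol' [measurable]: "(\<lambda>x. pack_vol n (\<lambda>u. S u \<and> \<not> C x u)) \<in> borel_measurable M"
    by (rule pack_vol_measurable; measurable)
  have [measurable]: "(\<lambda>z. pack_vol n (\<lambda>u. S u \<and> \<not> C (fst z) u)) \<in> borel_measurable (M \<Otimes>\<^sub>M M)"
    by (rule pack_vol_measurable; measurable)
  interpret pair_sigma_finite M M ..
  have "(\<Sum>j\<le>t. of_nat j * (of_nat (t choose j) * centre_vol S (t - j) j)) =
      (\<integral>\<^sup>+v. (\<Sum>j\<le>t. of_bool (S v) * (of_nat j * (of_nat (t choose j) *
         split_vol (t - j) j (\<lambda>u. S u \<and> \<not> C v u) (\<lambda>u. S u \<and> C v u)))) \<partial>M)"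
    unfolding centre_vol_def
    by (subst nn_integral_sum) (auto simp: nn_integral_cmult[symmetric] mult.left_commute)
  also have "\<dots> = (\<integral>\<^sup>+v. of_bool (S v) * (of_nat t *
      (\<integral>\<^sup>+x. of_bool (S x \<and> C v x) * pack_vol n (\<lambda>u. S u \<and> \<not> C x u) \<partial>M)) \<partial>M)"
  proof (rule nn_integral_cong)
    fix v assume [measurable]: "v \<in> space M"
    have e: "(\<lambda>u. ((S u \<and> \<not> C v u) \<or> (S u \<and> C v u)) \<and> \<not> C x u) = (\<lambda>u. S u \<and> \<not> C x u)" for x
      by auto
    show "(\<Sum>j\<le>t. of_bool (S v) * (of_nat j * (of_nat (t choose j) *
         split_vol (t - j) j (\<lambda>u. S u \<and> \<not> C v u) (\<lambda>u. S u \<and> C v u)))) = of_bool (S v) * (of_nat t *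
      (\<integral>\<^sup>+x. of_bool (S x \<and> C v x) * pack_vol n (\<lambda>u. S u \<and> \<not> C x u) \<partial>M))"
      unfolding sum_distrib_left[symmetric] Suc
      by (subst split_vol_mean) (auto simp only: e, measurable)
  qed
  also have "\<dots> = of_nat t * (\<integral>\<^sup>+v. (\<integral>\<^sup>+x. of_bool (S v) * (of_bool (S x) * of_bool (C v x)) *
      pack_vol n (\<lambda>u. S u \<and> \<not> C x u) \<partial>M) \<partial>M)"
    by (subst nn_integral_cmult[symmetric], measurable)
      (auto intro!: nn_integral_cong simp: mult.left_commute of_bool_conj nn_integral_cmult[symmetric] mult.assoc)
  also have "(\<integral>\<^sup>+v. (\<integral>\<^sup>+x. of_bool (S v) * (of_bool (S x) * of_bool (C v x)) *
      pack_vol n (\<lambda>u. S u \<and> \<not> C x u) \<partial>M) \<partial>M) =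
    (\<integral>\<^sup>+x. (\<integral>\<^sup>+v. of_bool (S v) * (of_bool (S x) * of_bool (C v x)) *
      pack_vol n (\<lambda>u. S u \<and> \<not> C x u) \<partial>M) \<partial>M)"
    by (rule Fubini') (unfold case_prod_unfold, measurable)
  also have "\<dots> = (\<integral>\<^sup>+x. (of_bool (S x) * pack_vol n (\<lambda>u. S u \<and> \<not> C x u)) * vol (\<lambda>v. S v \<and> C x v) \<partial>M)"
  proof (rule nn_integral_cong)
    fix x assume [measurable]: "x \<in> space M"
    show "(\<integral>\<^sup>+v. of_bool (S v) * (of_bool (S x) * of_bool (C v x)) * pack_vol n (\<lambda>u. S u \<and> \<not> C x u) \<partial>M) =
        (of_bool (S x) * pack_vol n (\<lambda>u. S u \<and> \<not> C x u)) * vol (\<lambda>v. S v \<and> C x v)"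
      by (subst nn_integral_of_bool[symmetric], measurable, subst nn_integral_cmult[symmetric], measurable)
        (auto intro!: nn_integral_cong simp: of_bool_def C_sym)
  qed
  also have "\<dots> \<le> (\<integral>\<^sup>+x. (of_bool (S x) * pack_vol n (\<lambda>u. S u \<and> \<not> C x u)) * \<Delta> \<partial>M)"
    by (intro nn_integral_mono mult_left_mono D) auto
  also have "\<dots> = \<Delta> * pack_vol t S"
    unfolding Suc pack_vol_Suc[OF S] by (subst nn_integral_multc, measurable) (simp add: mult.commute)
  finally show ?thesis by (simp add: mult_left_mono)
qed simp

section \<open>The tangent line bound in sparse neighbourhoods\<close>

text \<open>For the last bound \<open>pack_vol_Suc_ge\<close> is iterated: passing from
  \<open>i\<close> to \<open>i + 1\<close> points loses at most \<open>i * \<delta> * w ^ i\<close>.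
  Multiplied by the remaining powers of \<open>w\<close>, the losses add up to
  \<open>\<delta> * (0 + 1 + ... + (j - 1)) * w ^ (j - 1)\<close>.\<close>

lemma pack_vol_real_bounds:
  assumes T: "Measurable.pred M T" and w: "vol T = ennreal w" "0 \<le> w"
    and \<delta>: "0 \<le> \<delta>" "deg T \<le> ennreal \<delta> * vol T"
  shows "pack_vol j T = ennreal (enn2real (pack_vol j T))" "enn2real (pack_vol j T) \<le> w ^ j"
    "w ^ j - \<delta> * (real j * (real j - 1) / 2) * w ^ (j - 1) \<le> enn2real (pack_vol j T)"
proof -
  define q where "q j = enn2real (pack_vol j T)" for j
  have le: "pack_vol j T \<le> ennreal (w ^ j)" for j
    using pack_vol_le_power[OF T, of j] w by (simp add: ennreal_power)
  then have "pack_vol j T < \<infinity>" for j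
    using le_less_trans[of _ "ennreal (w ^ j)"] ennreal_less_top by (metis infinity_ennreal_def)
  then have q: "pack_vol j T = ennreal (q j)" for j by (simp add: q_def)
  then show "pack_vol j T = ennreal (enn2real (pack_vol j T))" by (simp add: q_def)
  have q0: "0 \<le> q j" for j by (simp add: q_def)
  show "enn2real (pack_vol j T) \<le> w ^ j"
    using le[of j] w by (simp add: enn2real_leI)
  have step: "w * q j \<le> q (Suc j) + real j * (\<delta> * w ^ j)" for j
  proof -
    have "ennreal (w * q j) = vol T * pack_vol j T" using w q0 q by (simp add: ennreal_mult)
    also have "\<dots> \<le> pack_vol (Suc j) T + of_nat j * (deg T * vol T ^ (j - 1))" by (rule pack_vol_Suc_ge[OF T])
    also have "\<dots> \<le> pack_vol (Suc j) T + of_nat j * ((ennreal \<delta> * vol T) * vol T ^ (j - 1))"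
      using \<delta> by (intro add_left_mono mult_left_mono mult_right_mono) auto
    also have "\<dots> = ennreal (q (Suc j) + real j * (\<delta> * w ^ j))"
    proof (cases j)
      case (Suc i)
      then show ?thesis
        using w \<delta> q0 by (simp add: q ennreal_mult ennreal_plus ennreal_power ennreal_of_nat_eq_real_of_nat
            mult.assoc del: of_nat_Suc)
    qed (simp add: q)
    finally show ?thesis using w \<delta> q0 by (subst (asm) ennreal_le_iff) auto
  qed
  have "w ^ j - \<delta> * (real j * (real j - 1) / 2) * w ^ (j - 1) \<le> q j" for j
  proof (induction j)
    case 0
    then show ?case by (simp add: q_def)
  next
    case (Suc j)
    have "w * (w ^ j - \<delta> * (real j * (real j - 1) / 2) * w ^ (j - 1)) \<le> w * q j"
      using Suc w by (intro mult_left_mono) auto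
    then have "w * (w ^ j - \<delta> * (real j * (real j - 1) / 2) * w ^ (j - 1)) - real j * (\<delta> * w ^ j) \<le> q (Suc j)"
      using step[of j] by linarith
    moreover have "w * (w ^ j - \<delta> * (real j * (real j - 1) / 2) * w ^ (j - 1)) - real j * (\<delta> * w ^ j) =
        w ^ Suc j - \<delta> * (real (Suc j) * (real (Suc j) - 1) / 2) * w ^ (Suc j - 1)"
      by (cases j) (simp_all add: field_simps)
    ultimately show ?case by simp
  qed
  then show "w ^ j - \<delta> * (real j * (real j - 1) / 2) * w ^ (j - 1) \<le> enn2real (pack_vol j T)"
    by (simp add: q_def)
qed

text \<open>This is \<open>truncated_tangent_bound\<close> with \<open>x = lam * w\<close> and
  \<open>\<beta> = lam * \<delta> / 2\<close>. Positive and negative parts of \<open>y - j\<close>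
  stand on opposite sides, so that all terms are nonnegative and can be integrated.\<close>

lemma pack_vol_tangent_bound:
  assumes T: "Measurable.pred M T" and w: "vol T = ennreal w" "0 \<le> w"
    and \<delta>: "0 \<le> \<delta>" "deg T \<le> ennreal \<delta> * vol T"
    and lam: "0 < lam" and y: "1 \<le> y" and J: "12 * y \<le> real J"
    and small: "lam * \<delta> / 2 * real J * (4 * y) * exp (2 * y) \<le> 1"
  shows "(\<Sum>j\<le>J. ennreal (max 0 (y - real j) * (lam ^ j / fact j)) * pack_vol j T) \<le>
    ennreal (2 * exp (y - 1)) + (\<Sum>j\<le>J. ennreal (max 0 (real j - y) * (lam ^ j / fact j)) * pack_vol j T)"
proof -
  define q where "q j = enn2real (pack_vol j T)" for j
  note bounds = pack_vol_real_bounds[OF T w \<delta>, folded q_def]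
  define z where "z j = lam ^ j / fact j * q j" for j
  have z0: "0 \<le> z j" for j using lam by (simp add: z_def q_def)
  have sum: "(\<Sum>j\<le>J. (y - real j) * z j) \<le> 2 * exp (y - 1)"
  proof (rule truncated_tangent_bound[where x = "lam * w" and \<beta> = "lam * \<delta> / 2", OF _ y J _ small])
    fix j
    show "z j \<le> (lam * w) ^ j / fact j"
      using bounds(2)[of j] lam by (simp add: z_def power_mult_distrib divide_right_mono mult_left_mono)
    assume j: "2 \<le> j"
    then obtain i where i: "j = Suc (Suc i)" by (metis Suc_le_D numeral_2_eq_2 Suc_le_mono)
    \<comment> \<open>\<open>c\<close> is twice the number of pairs;
      \<open>fact j = c * fact (j - 2)\<close> brings the pair loss into the shape of
      \<open>lower\<close>.\<close>
    define c where "c = real j * (real j - 1)"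
    have c: "c \<noteq> 0" "(fact j :: real) = c * fact (j - 2)"
      using j by (simp add: c_def) (simp add: c_def i algebra_simps)
    have "lam ^ j / fact j * (\<delta> * (c / 2) * w ^ (j - 1)) =
        lam * \<delta> / 2 * ((lam * w) ^ (j - 1) / fact (j - 2))"
      using c(1) unfolding c(2) by (simp add: i power_mult_distrib mult_ac)
    then have "(lam * w) ^ j / fact j - lam * \<delta> / 2 * ((lam * w) ^ (j - 1) / fact (j - 2)) =
        lam ^ j / fact j * (w ^ j - \<delta> * (real j * (real j - 1) / 2) * w ^ (j - 1))"
      unfolding c_def by (simp add: right_diff_distrib power_mult_distrib)
    also have "\<dots> \<le> z j"
      unfolding z_def using bounds(3)[of j] lam by (intro mult_left_mono) auto
    finally show "(lam * w) ^ j / fact j - lam * \<delta> / 2 * ((lam * w) ^ (j - 1) / fact (j - 2)) \<le> z j" .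
  qed (use lam w \<delta> in auto)
  have e: "ennreal (c * (lam ^ j / fact j)) * pack_vol j T = ennreal (c * z j)" if "0 \<le> c" for c j
    using that lam by (subst bounds(1)) (simp add: ennreal_mult[symmetric] q_def z_def mult.assoc)
  have "(\<Sum>j\<le>J. (y - real j) * z j) = (\<Sum>j\<le>J. max 0 (y - real j) * z j - max 0 (real j - y) * z j)"
    by (intro sum.cong) (auto simp: max_def left_diff_distrib)
  with sum have "(\<Sum>j\<le>J. max 0 (y - real j) * z j) \<le>
      2 * exp (y - 1) + (\<Sum>j\<le>J. max 0 (real j - y) * z j)"
    by (simp add: sum_subtractf)
  then have "ennreal (\<Sum>j\<le>J. max 0 (y - real j) * z j) \<le>
      ennreal (2 * exp (y - 1) + (\<Sum>j\<le>J. max 0 (real j - y) * z j))"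
    by (rule ennreal_leI)
  moreover have "(\<Sum>j\<le>J. ennreal (max 0 (f j) * (lam ^ j / fact j)) * pack_vol j T) =
      ennreal (\<Sum>j\<le>J. max 0 (f j) * z j)" for f :: "nat \<Rightarrow> real"
  proof -
    have "(\<Sum>j\<le>J. ennreal (max 0 (f j) * (lam ^ j / fact j)) * pack_vol j T) =
        (\<Sum>j\<le>J. ennreal (max 0 (f j) * z j))"
      by (intro sum.cong refl e) simp
    then show ?thesis using z0 by (simp add: sum_ennreal)
  qed
  ultimately show ?thesis using z0 by (simp only:) (subst ennreal_plus[symmetric], auto intro!: sum_nonneg)
qed

text \<open>Sparsity of neighbourhoods: a uniformly random pair in any \<open>T\<close> inside one neighbourhood
  conflicts with probability at most \<open>\<delta> / vol T\<close>.\<close>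
definition sparse :: "('a \<Rightarrow> bool) \<Rightarrow> real \<Rightarrow> bool" where
  "sparse S \<delta> \<longleftrightarrow> (\<forall>v\<in>space M. \<forall>T. Measurable.pred M T \<longrightarrow> (\<forall>u. T u \<longrightarrow> S u \<and> C v u) \<longrightarrow>
     deg T \<le> ennreal \<delta> * vol T)"

lemma sparseD:
  "sparse S \<delta> \<Longrightarrow> v \<in> space M \<Longrightarrow> Measurable.pred M T \<Longrightarrow> (\<And>u. T u \<Longrightarrow> S u \<and> C v u) \<Longrightarrow>
    deg T \<le> ennreal \<delta> * vol T"
  by (simp add: sparse_def)

text \<open>Fix the centre \<open>v\<close> and the \<open>i\<close> points not in conflict with it.
  The others range over a region inside the neighbourhood of \<open>v\<close>, where
  \<open>sparse\<close> supplies the degree hypothesis of \<open>pack_vol_tangent_bound\<close>. The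
  bound is then integrated over the \<open>i\<close> points and over \<open>v\<close>.\<close>

lemma centre_vol_tangent_bound:
  assumes S [measurable]: "Measurable.pred M S" and fin: "vol S < \<infinity>" and sp: "sparse S \<delta>" and \<delta>: "0 \<le> \<delta>"
    and lam: "0 < lam" and y: "1 \<le> y" and J: "12 * y \<le> real J"
    and small: "lam * \<delta> / 2 * real J * (4 * y) * exp (2 * y) \<le> 1"
  shows "(\<Sum>j\<le>J. ennreal (max 0 (y - real j) * (lam ^ j / fact j)) * centre_vol S i j) \<le>
    ennreal (2 * exp (y - 1)) * centre_vol S i 0 +
    (\<Sum>j\<le>J. ennreal (max 0 (real j - y) * (lam ^ j / fact j)) * centre_vol S i j)"
proof -
  let ?p = "\<lambda>j. ennreal (max 0 (y - real j) * (lam ^ j / fact j))"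
  let ?m = "\<lambda>j. ennreal (max 0 (real j - y) * (lam ^ j / fact j))"
  let ?c = "ennreal (2 * exp (y - 1))"
  note [measurable] = centre_vol_integrand_measurable[OF S]
  have RR: "(\<Sum>j\<le>J. ?p j * split_vol i j B D) \<le> ?c * split_vol i 0 B D + (\<Sum>j\<le>J. ?m j * split_vol i j B D)"
    if B [measurable]: "Measurable.pred M B" and D [measurable]: "Measurable.pred M D"
      and v: "v \<in> space M" "\<And>u. D u \<Longrightarrow> S u \<and> C v u" for B D v
  proof -
    let ?P = "Pi\<^sub>M {..<i} (\<lambda>_. M)"
    let ?D = "\<lambda>Y u. D u \<and> (\<forall>k<i. \<not> C (Y k) u)"
    have qm [measurable]: "(\<lambda>Y. of_bool (packing i B Y) * pack_vol j (?D Y)) \<in> borel_measurable ?P" for j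
      using measurable_compose[OF measurable_Pair1' split_vol_integrand_measurable[where P = "count_space UNIV"
        and F = "\<lambda>_. B" and G = "\<lambda>_. D", OF pred_const_param[OF B] pred_const_param[OF D]],
        of undefined i] by simp
    have pk [measurable]: "(\<lambda>Y. of_bool (packing i B Y) :: ennreal) \<in> borel_measurable ?P"
      by (rule of_bool_measurable, rule packing_measurable[OF pred_const_param[OF B],
            where f = "\<lambda>_. undefined" and P = "count_space UNIV"]) simp_all
    have int: "(\<integral>\<^sup>+Y. (\<Sum>j\<le>J. f j * (of_bool (packing i B Y) * pack_vol j (?D Y))) \<partial>?P) =
          (\<Sum>j\<le>J. f j * split_vol i j B D)"
        "(\<integral>\<^sup>+Y. c * of_bool (packing i B Y) +
          (\<Sum>j\<le>J. f j * (of_bool (packing i B Y) * pack_vol j (?D Y))) \<partial>?P) =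
          c * split_vol i 0 B D + (\<Sum>j\<le>J. f j * split_vol i j B D)" for c f
      unfolding split_vol_zero_right unfolding split_vol_def pack_vol_def[of i]
      by (rule nn_integral_weighted_sum; (rule pk qm))+
    have "(\<Sum>j\<le>J. ?p j * split_vol i j B D) \<le> (\<integral>\<^sup>+Y. ?c * of_bool (packing i B Y) +
        (\<Sum>j\<le>J. ?m j * (of_bool (packing i B Y) * pack_vol j (?D Y))) \<partial>?P)"
      unfolding int(1)[symmetric]
    proof (rule nn_integral_mono)
      fix Y assume Y: "Y \<in> space ?P"
      have Yk: "Y k \<in> space M" if "k < i" for k
        using Y that by (auto simp: space_PiM)
      have DY: "Measurable.pred M (?D Y)"
        by (rule free_measurable[OF D measurable_ident_sets[OF refl] measurable_const[OF Yk]])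
      have "vol (?D Y) \<le> vol S" using v(2) S by (intro vol_mono) blast+
      then have f: "vol (?D Y) < \<infinity>" using fin by (rule le_less_trans)
      have "(\<Sum>j\<le>J. ?p j * pack_vol j (?D Y)) \<le> ?c + (\<Sum>j\<le>J. ?m j * pack_vol j (?D Y))"
      proof (rule pack_vol_tangent_bound[where w = "enn2real (vol (?D Y))", OF DY _ _ \<delta> _ lam y J small])
        show "deg (?D Y) \<le> ennreal \<delta> * vol (?D Y)"
          by (rule sparseD[OF sp v(1) DY]) (use v(2) in blast)
        show "vol (?D Y) = ennreal (enn2real (vol (?D Y)))" using f by simp
      qed simp
      then show "(\<Sum>j\<le>J. ?p j * (of_bool (packing i B Y) * pack_vol j (?D Y))) \<le>
          ?c * of_bool (packing i B Y) + (\<Sum>j\<le>J. ?m j * (of_bool (packing i B Y) * pack_vol j (?D Y)))"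
        by (cases "packing i B Y") (simp_all only: of_bool_eq mult_1 mult_1_right mult_zero_left
            mult_zero_right sum.neutral_const add_0_left order_refl)
    qed
    also have "\<dots> = ?c * split_vol i 0 B D + (\<Sum>j\<le>J. ?m j * split_vol i j B D)"
      by (rule int(2))
    finally show ?thesis .
  qed
  let ?split_vol = "\<lambda>v j. split_vol i j (\<lambda>u. S u \<and> \<not> C v u) (\<lambda>u. S u \<and> C v u)"
  have Rm: "(\<lambda>v. of_bool (S v) * ?split_vol v j) \<in> borel_measurable M" for j
    by measurable
  have int: "(\<integral>\<^sup>+v. (\<Sum>j\<le>J. f j * (of_bool (S v) * ?split_vol v j)) \<partial>M) = (\<Sum>j\<le>J. f j * centre_vol S i j)"
      "(\<integral>\<^sup>+v. c * (of_bool (S v) * ?split_vol v 0) + (\<Sum>j\<le>J. f j * (of_bool (S v) * ?split_vol v j)) \<partial>M) =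
        c * centre_vol S i 0 + (\<Sum>j\<le>J. f j * centre_vol S i j)" for c f
    unfolding centre_vol_def by (rule nn_integral_weighted_sum; rule Rm)+
  have "(\<Sum>j\<le>J. ?p j * centre_vol S i j) \<le> (\<integral>\<^sup>+v. ?c * (of_bool (S v) * ?split_vol v 0) +
      (\<Sum>j\<le>J. ?m j * (of_bool (S v) * ?split_vol v j)) \<partial>M)"
    unfolding int(1)[symmetric]
  proof (rule nn_integral_mono)
    fix v assume v [measurable]: "v \<in> space M"
    have "(\<Sum>j\<le>J. ?p j * ?split_vol v j) \<le> ?c * ?split_vol v 0 + (\<Sum>j\<le>J. ?m j * ?split_vol v j)"
      by (rule RR[OF _ _ v]) auto
    then show "(\<Sum>j\<le>J. ?p j * (of_bool (S v) * ?split_vol v j)) \<le> ?c * (of_bool (S v) * ?split_vol v 0) +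
      (\<Sum>j\<le>J. ?m j * (of_bool (S v) * ?split_vol v j))"
      by (cases "S v") (simp_all only: of_bool_eq mult_1 mult_zero_left
            mult_zero_right sum.neutral_const add_0_left order_refl)
  qed
  also have "\<dots> = ?c * centre_vol S i 0 + (\<Sum>j\<le>J. ?m j * centre_vol S i j)"
    by (rule int(2))
  finally show ?thesis .
qed

section \<open>From averaged conflicts to a lower bound on the packing volume\<close>

text \<open>\<open>top_levels_dominate\<close> is applied to
  \<open>lam ^ (i + j) / (i! * j!)\<close> times \<open>centre_vol S i j\<close>. Its hypotheses are
  the facts about \<open>centre_vol\<close> brought back from \<open>ennreal\<close> to the
  reals.\<close>

theorem partition_top_levels:
  fixes y V \<Delta> \<delta> lam :: real
  assumes S [measurable]: "Measurable.pred M S" and V: "vol S = ennreal V" "0 < V"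
    and \<Delta>: "0 \<le> \<Delta>" "\<And>x. x \<in> space M \<Longrightarrow> vol (\<lambda>u. S u \<and> C x u) \<le> ennreal \<Delta>"
    and sp: "sparse S \<delta>" and \<delta>: "0 \<le> \<delta>"
    and lam: "0 < lam" and y: "1 \<le> y" and J: "12 * y \<le> real J" "J \<le> s"
    and small: "lam * \<delta> / 2 * real J * (4 * y) * exp (2 * y) \<le> 1"
  defines "a \<equiv> \<lambda>t. lam ^ t / fact t * enn2real (pack_vol t S)"
  shows "(y * V - \<Delta> * real s - 2 * exp (y - 1) * real s / lam) * (\<Sum>t\<le>s. a t)
    \<le> y * V * (\<Sum>t\<in>{s - J<..s}. a t)"
proof -
  define q where "q t = enn2real (pack_vol t S)" for t
  have q0: "0 \<le> q t" for t by (simp add: q_def)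
  have "pack_vol t S \<le> ennreal (V ^ t)" for t
    using pack_vol_le_power[OF S, of t] V by (simp add: ennreal_power)
  then have "pack_vol t S < \<infinity>" for t
    using le_less_trans[of _ "ennreal (V ^ t)"] ennreal_less_top by (metis infinity_ennreal_def)
  then have q: "pack_vol t S = ennreal (q t)" for t by (simp add: q_def)
  define w where "w i j = enn2real (centre_vol S i j)" for i j
  have w0: "0 \<le> w i j" for i j by (simp add: w_def)
  have "centre_vol S i j < \<infinity>" for i j
  proof -
    \<comment> \<open>This is one summand of the finite total in
      \<open>centre_vol_mass\<close>.\<close>
    have "of_nat (i + j choose j) * centre_vol S (i + j - j) j \<le>
        (\<Sum>j'\<le>i + j. of_nat (i + j choose j') * centre_vol S (i + j - j') j')"
      by (rule member_le_sum) auto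
    also have "\<dots> = ennreal (V * q (i + j))"
      using V q0 by (simp add: centre_vol_mass[OF S] q ennreal_mult)
    finally have "of_nat (i + j choose j) * centre_vol S i j < \<infinity>"
      using le_less_trans ennreal_less_top by (metis add_diff_cancel_right' infinity_ennreal_def)
    moreover have "(of_nat (i + j choose j) :: ennreal) \<noteq> 0"
      by (simp del: of_nat_add)
    ultimately show ?thesis
      by (auto simp: ennreal_mult_less_top)
  qed
  then have w: "centre_vol S i j = ennreal (w i j)" for i j by (simp add: w_def)
  define r where "r i j = (lam ^ i / fact i) * (lam ^ j / fact j) * w i j" for i j
  \<comment> \<open>The binomial coefficient is \<open>t! / ((t - j)! * j!)\<close>, which the
    normalisation of \<open>r\<close> absorbs.\<close>
  have bin: "r (t - j) j = lam ^ t / fact t * (real (t choose j) * w (t - j) j)" if "j \<le> t" for t j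
  proof -
    have "lam ^ t = lam ^ (t - j) * lam ^ j" using that by (simp add: power_add[symmetric])
    then show ?thesis
      unfolding r_def using binomial_fact[OF that, where ?'a = real] by (simp add: mult.commute)
  qed
  have "(y * V - \<Delta> * real s - 2 * exp (y - 1) * real s / lam) * (\<Sum>t\<le>s. a t)
    \<le> y * V * (\<Sum>t\<in>{s - J<..s}. a t)"
  proof (rule top_levels_dominate[where r = r])
    show "(\<Sum>j\<le>t. r (t - j) j) = V * a t" for t
    proof -
      have "ennreal (\<Sum>j\<le>t. real (t choose j) * w (t - j) j) = ennreal (V * q t)"
        using centre_vol_mass[OF S, of t] V w0 q0
        by (simp add: w q ennreal_mult sum_ennreal[symmetric] ennreal_of_nat_eq_real_of_nat)
      then have "(\<Sum>j\<le>t. real (t choose j) * w (t - j) j) = V * q t"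
        using V w0 q0 by (subst (asm) ennreal_inj) (auto intro!: sum_nonneg)
      then have "lam ^ t / fact t * (\<Sum>j\<le>t. real (t choose j) * w (t - j) j) = V * a t"
        by (simp add: a_def q_def)
      then show ?thesis by (simp add: bin sum_distrib_left)
    qed
    show "(\<Sum>j\<le>t. real j * r (t - j) j) \<le> \<Delta> * real t * a t" for t
    proof -
      have "ennreal (\<Sum>j\<le>t. real j * (real (t choose j) * w (t - j) j)) \<le> ennreal (real t * (\<Delta> * q t))"
        using centre_vol_mean[OF S \<Delta>(2), of t] \<Delta>(1) w0 q0
        by (simp add: w q ennreal_mult sum_ennreal[symmetric] ennreal_of_nat_eq_real_of_nat)
      then have "(\<Sum>j\<le>t. real j * (real (t choose j) * w (t - j) j)) \<le> real t * (\<Delta> * q t)"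
        using \<Delta>(1) w0 q0 by (subst (asm) ennreal_le_iff) auto
      then have "lam ^ t / fact t * (\<Sum>j\<le>t. real j * (real (t choose j) * w (t - j) j)) \<le>
          lam ^ t / fact t * (real t * (\<Delta> * q t))"
        using lam by (intro mult_left_mono) auto
      moreover have "(\<Sum>j\<le>t. real j * r (t - j) j) =
          lam ^ t / fact t * (\<Sum>j\<le>t. real j * (real (t choose j) * w (t - j) j))"
        unfolding sum_distrib_left by (intro sum.cong) (auto simp: bin)
      ultimately show ?thesis by (simp add: a_def q_def mult_ac)
    qed
    show "r i 0 = real (Suc i) * a (Suc i) / lam" for i
    proof -
      have "w i 0 = q (Suc i)" by (simp add: w_def q_def centre_vol_free[OF S])
      then show ?thesis using lam by (simp add: r_def a_def q_def[symmetric] fact_Suc del: of_nat_Suc)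
    qed
    show "(\<Sum>j\<le>J. (y - real j) * r i j) \<le> 2 * exp (y - 1) * r i 0" for i
    proof -
      let ?p = "\<lambda>j. max 0 (y - real j) * (lam ^ j / fact j)"
      let ?m = "\<lambda>j. max 0 (real j - y) * (lam ^ j / fact j)"
      have c0: "0 \<le> ?p j" "0 \<le> ?m j" for j using lam by auto
      have ws: "(\<Sum>j\<le>J. ennreal (g j) * centre_vol S i j) = ennreal (\<Sum>j\<le>J. g j * w i j)"
        if "\<And>j. 0 \<le> g j" for g
        using that w0 by (simp add: w ennreal_mult[symmetric] sum_ennreal)
      have fin: "vol S < \<infinity>" using V by simp
      have s0: "0 \<le> (\<Sum>j\<le>J. ?m j * w i j)" by (intro sum_nonneg mult_nonneg_nonneg[OF c0(2) w0])
      have "ennreal (\<Sum>j\<le>J. ?p j * w i j) \<le>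
          ennreal (2 * exp (y - 1)) * centre_vol S i 0 + ennreal (\<Sum>j\<le>J. ?m j * w i j)"
        using centre_vol_tangent_bound[OF S fin sp \<delta> lam y J(1) small, of i]
        unfolding ws[OF c0(1)] ws[OF c0(2)] .
      also have "\<dots> = ennreal (2 * exp (y - 1) * w i 0 + (\<Sum>j\<le>J. ?m j * w i j))"
        using s0 w0 by (subst ennreal_plus) (simp_all add: w ennreal_mult)
      finally have "ennreal (\<Sum>j\<le>J. ?p j * w i j) \<le>
          ennreal (2 * exp (y - 1) * w i 0 + (\<Sum>j\<le>J. ?m j * w i j))" .
      then have "(\<Sum>j\<le>J. ?p j * w i j) \<le> 2 * exp (y - 1) * w i 0 + (\<Sum>j\<le>J. ?m j * w i j)"
        using s0 w0 by (subst (asm) ennreal_le_iff) simp_all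
      then have "(\<Sum>j\<le>J. ?p j * w i j - ?m j * w i j) \<le> 2 * exp (y - 1) * w i 0"
        by (simp add: sum_subtractf)
      moreover have "?p j * w i j - ?m j * w i j = (y - real j) * (lam ^ j / fact j * w i j)" for j
      proof -
        have "y - real j = max 0 (y - real j) - max 0 (real j - y)" by simp
        then show ?thesis by (metis left_diff_distrib mult.assoc)
      qed
      ultimately have "(lam ^ i / fact i) * (\<Sum>j\<le>J. (y - real j) * (lam ^ j / fact j * w i j)) \<le>
          (lam ^ i / fact i) * (2 * exp (y - 1) * w i 0)"
        using lam by (intro mult_left_mono) (simp_all only:, auto)
      then show ?thesis
        unfolding r_def sum_distrib_left by (simp add: mult_ac)
    qed
  qed (use V lam \<Delta> y J q0 w0 in \<open>auto simp: r_def a_def\<close>)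
  then show ?thesis .
qed

text \<open>For \<open>s = N + J\<close>, \<open>large\<close> makes the left factor in
  \<open>partition_top_levels\<close> at least \<open>V / 2\<close>, and the total weight is at
  least 1, the weight of the empty packing. So the \<open>J\<close> levels above \<open>N\<close>
  carry at least \<open>1 / (2 * y)\<close>.\<close>

lemma packing_probability:
  fixes y V \<Delta> \<delta> lam :: real
  assumes S [measurable]: "Measurable.pred M S" and V: "vol S = ennreal V" "0 < V"
    and \<Delta>: "0 \<le> \<Delta>" "\<And>x. x \<in> space M \<Longrightarrow> vol (\<lambda>u. S u \<and> C x u) \<le> ennreal \<Delta>"
    and sp: "sparse S \<delta>" and \<delta>: "0 \<le> \<delta>"
    and lam: "0 < lam" and y: "1 \<le> y" and J: "12 * y \<le> real J"
    and small: "lam * \<delta> / 2 * real J * (4 * y) * exp (2 * y) \<le> 1"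
    and large: "\<Delta> * real (N + J) + 2 * exp (y - 1) * real (N + J) / lam \<le> (y - 1 / 2) * V"
  obtains t where "N < t" "t \<le> N + J"
    "fact t / (lam * V) ^ t / (2 * y * real J) \<le> enn2real (pack_vol N S) / V ^ N"
proof -
  define a where "a t = lam ^ t / fact t * enn2real (pack_vol t S)" for t
  have a0: "0 \<le> a t" for t using lam by (simp add: a_def)
  have J0: "0 < real J" using J y by linarith
  have top: "(y * V - \<Delta> * real (N + J) - 2 * exp (y - 1) * real (N + J) / lam) * (\<Sum>t\<le>N + J. a t)
    \<le> y * V * (\<Sum>t\<in>{N<..N + J}. a t)"
    using partition_top_levels[OF S V \<Delta> sp \<delta> lam y J _ small, of "N + J"] by (simp add: a_def)
  have "a 0 \<le> (\<Sum>t\<le>N + J. a t)" by (rule member_le_sum) (auto simp: a0)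
  then have Z: "1 \<le> (\<Sum>t\<le>N + J. a t)" by (simp add: a_def)
  have "V / 2 * 1 \<le> (y * V - \<Delta> * real (N + J) - 2 * exp (y - 1) * real (N + J) / lam) * (\<Sum>t\<le>N + J. a t)"
    using large V Z by (intro mult_mono) (auto simp: algebra_simps)
  with top have "V / 2 \<le> y * V * (\<Sum>t\<in>{N<..N + J}. a t)" by linarith
  then have sum: "1 / (2 * y) \<le> (\<Sum>t\<in>{N<..N + J}. a t)"
    using V y by (simp add: field_simps)
  \<comment> \<open>Pigeonhole: one of the \<open>J\<close> levels has at least the average
    weight.\<close>
  have "\<exists>t\<in>{N<..N + J}. 1 / (2 * y * real J) \<le> a t"
  proof (rule ccontr)
    assume "\<not> ?thesis"
    then have "a t < 1 / (2 * y * real J)" if "t \<in> {N<..N + J}" for t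
      using that by (meson not_le)
    then have "(\<Sum>t\<in>{N<..N + J}. a t) < (\<Sum>t\<in>{N<..N + J}. 1 / (2 * y * real J))"
      using J0 by (intro sum_strict_mono) simp_all
    also have "\<dots> = 1 / (2 * y)" using J0 by simp
    finally show False using sum by simp
  qed
  then obtain t where t: "N < t" "t \<le> N + J" and at: "1 / (2 * y * real J) \<le> a t" by auto
  have fin: "pack_vol t S < \<infinity>" for t
    using pack_vol_le_power[OF S, of t] V le_less_trans[of _ "vol S ^ t"]
    by (simp add: ennreal_power)
  \<comment> \<open>Descent from level \<open>t\<close> to level \<open>N\<close>: each extra point
    multiplies the volume by at most \<open>V\<close>.\<close>
  have "enn2real (pack_vol (N + d) S) \<le> V ^ d * enn2real (pack_vol N S)" for d
  proof (induction d)
    case (Suc d)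
    have "enn2real (pack_vol (Suc (N + d)) S) \<le> enn2real (vol S * pack_vol (N + d) S)"
      using pack_vol_Suc_le[OF S, of "N + d"] fin[of "N + d"] V
      by (intro enn2real_mono) (auto simp: ennreal_mult_less_top)
    also have "\<dots> = V * enn2real (pack_vol (N + d) S)" using V by (simp add: enn2real_mult)
    also have "\<dots> \<le> V * (V ^ d * enn2real (pack_vol N S))" using Suc V by (intro mult_left_mono) auto
    finally show ?case by (simp add: mult.assoc)
  qed simp
  from this[of "t - N"] t have mono: "enn2real (pack_vol t S) \<le> V ^ (t - N) * enn2real (pack_vol N S)" by simp
  have "fact t / (lam * V) ^ t / (2 * y * real J) = fact t / (lam * V) ^ t * (1 / (2 * y * real J))"
    by simp
  also have "\<dots> \<le> fact t / (lam * V) ^ t * a t"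
    using at lam V by (intro mult_left_mono) auto
  also have "\<dots> = enn2real (pack_vol t S) / V ^ t"
    using lam V by (simp add: a_def power_mult_distrib)
  also have "\<dots> \<le> V ^ (t - N) * enn2real (pack_vol N S) / V ^ t"
    using mono V by (intro divide_right_mono) auto
  also have "V ^ t = V ^ (t - N) * V ^ N" using t by (simp add: power_add[symmetric])
  finally have "fact t / (lam * V) ^ t / (2 * y * real J) \<le> enn2real (pack_vol N S) / V ^ N"
    using V by simp
  with t show ?thesis by (rule that)
qed

theorem packing_entropy:
  fixes D V \<Delta> \<delta> \<alpha> :: real
  assumes S [measurable]: "Measurable.pred M S" and V: "vol S = ennreal V" "0 < V"
    and \<Delta>: "0 < \<Delta>" "\<And>x. x \<in> space M \<Longrightarrow> vol (\<lambda>u. S u \<and> C x u) \<le> ennreal \<Delta>"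
    and sp: "sparse S \<delta>" and \<delta>: "0 \<le> \<delta>" and D: "0 < D" and \<alpha>: "\<alpha> = D / \<Delta>"
    and J: "12 * (D + 1) \<le> real J"
    and small: "16 * exp D * \<alpha> * \<delta> / 2 * real J * (4 * (D + 1)) * exp (2 * (D + 1)) \<le> 1"
    and large: "\<Delta> * real J + real J / (8 * \<alpha>) \<le> 3 / 8 * V"
      "(D + 4) * real J + ln (2 * (D + 1) * real J) \<le> \<alpha> * V"
  defines "N \<equiv> nat \<lfloor>\<alpha> * V\<rfloor>"
  shows "0 < enn2real (pack_vol N S)" "- (D + 5) * (\<alpha> * V) \<le> ln (enn2real (pack_vol N S) / V ^ N)"
proof -
  \<comment> \<open>With this value \<open>2 * exp D / lam = 1 / (8 * \<alpha>)\<close>. Then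
    \<open>(\<Delta> + 1 / (8 * \<alpha>)) * (\<alpha> * V) = (D + 1 / 8) * V\<close>, and the
    \<open>3 / 8 * V\<close> reserved for \<open>J\<close> completes it to
    \<open>(y - 1 / 2) * V\<close> at \<open>y = D + 1\<close>.\<close>
  define lam where "lam = 16 * exp D * \<alpha>"
  have \<alpha>0: "0 < \<alpha>" using \<alpha> D \<Delta> by simp
  have lam0: "0 < lam" using \<alpha>0 by (simp add: lam_def)
  have "0 < 12 * (D + 1)" using D by simp
  then have J0: "0 < real J" using J by (rule less_le_trans)
  have N: "real N \<le> \<alpha> * V" "\<alpha> * V < real N + 1"
    unfolding N_def using \<alpha>0 V by (auto simp: of_nat_nat floor_le_iff)
  have "\<Delta> * real (N + J) + 2 * exp (D + 1 - 1) * real (N + J) / lam =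
      (\<Delta> + 1 / (8 * \<alpha>)) * real N + (\<Delta> * real J + real J / (8 * \<alpha>))"
    using \<alpha>0 by (simp add: lam_def field_simps)
  also have "\<dots> \<le> (\<Delta> + 1 / (8 * \<alpha>)) * (\<alpha> * V) + 3 / 8 * V"
    using N \<Delta> \<alpha>0 large by (intro add_mono mult_left_mono) auto
  also have "\<dots> = (D + 1 - 1 / 2) * V"
    using \<Delta> \<alpha>0 D by (simp add: \<alpha> field_simps)
  finally have "\<Delta> * real (N + J) + 2 * exp (D + 1 - 1) * real (N + J) / lam \<le> (D + 1 - 1 / 2) * V" .
  then obtain t where t: "N < t" "t \<le> N + J"
    and P: "fact t / (lam * V) ^ t / (2 * (D + 1) * real J) \<le> enn2real (pack_vol N S) / V ^ N"
    using packing_probability[OF S V _ \<Delta>(2) sp \<delta> lam0 _ J, of N] small D \<Delta>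
    by (auto simp: lam_def)
  have t0: "0 < real t" using t by simp
  have "real t ^ t / fact t \<le> exp (real t)" by (rule power_div_fact_le_exp) simp
  then have f: "real t ^ t / exp (real t) \<le> fact t" by (simp add: field_simps)
  \<comment> \<open>\<open>\<alpha> / lam = exp (- D) / 16\<close> and
    \<open>16 \<le> exp 3\<close>; the 4 is this 3 plus the 1 from Stirling's factor
    \<open>exp t\<close>.\<close>
  have e: "exp (- (D + 4)) \<le> \<alpha> / (exp 1 * lam)"
  proof -
    \<comment> \<open>\<open>exp (1 / 2) \<ge> 1 + 1 / 2 + 1 / 8 = 13 / 8\<close>, whose sixth power
      exceeds 16.\<close>
    have "(13 / 8) ^ 6 \<le> exp (1 / 2 :: real) ^ 6"
      using exp_lower_Taylor_quadratic[of "1 / 2"] by (intro power_mono) (auto simp: power2_eq_square)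
    also have "\<dots> = exp 3" by (simp add: exp_of_nat_mult[symmetric])
    finally have "16 \<le> exp (3::real)" by (simp add: power_numeral_reduce)
    then have "exp (- D) / (exp 3 * exp 1) \<le> exp (- D) / (16 * exp (1::real))"
      by (intro divide_left_mono mult_right_mono) auto
    moreover have "exp (- (D + 4)) = exp (- D) / (exp 3 * exp 1)"
      using exp_diff[of "- D" 4] exp_add[of 3 "1::real"] by simp
    moreover have "\<alpha> / (exp 1 * lam) = exp (- D) / (16 * exp 1)"
      using \<alpha>0 by (simp add: lam_def exp_minus field_simps)
    ultimately show ?thesis by simp
  qed
  have "exp (- (D + 4) * real t) = exp (- (D + 4)) ^ t" by (simp add: exp_of_nat_mult[symmetric] mult.commute)
  also have "\<dots> \<le> (real t / (exp 1 * (lam * V))) ^ t"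
  proof (rule power_mono)
    have "\<alpha> * V \<le> real t" using N t by linarith
    then have "\<alpha> \<le> real t / V" using V by (simp add: field_simps)
    then have "\<alpha> / (exp 1 * lam) \<le> real t / V / (exp 1 * lam)"
      using lam0 by (intro divide_right_mono) auto
    with e show "exp (- (D + 4)) \<le> real t / (exp 1 * (lam * V))" by (simp add: mult_ac)
  qed simp
  also have "\<dots> = real t ^ t / exp (real t) / (lam * V) ^ t"
    by (simp add: power_divide power_mult_distrib exp_of_nat_mult[symmetric])
  also have "\<dots> \<le> fact t / (lam * V) ^ t"
    using f lam0 V by (intro divide_right_mono) auto
  finally have "exp (- (D + 4) * real t) / (2 * (D + 1) * real J) \<le> fact t / (lam * V) ^ t / (2 * (D + 1) * real J)"
    using J0 D by (intro divide_right_mono) auto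
  with P have P': "exp (- (D + 4) * real t) / (2 * (D + 1) * real J) \<le> enn2real (pack_vol N S) / V ^ N" by linarith
  have pos: "0 < exp (- (D + 4) * real t) / (2 * (D + 1) * real J)" using D J0 by simp
  from less_le_trans[OF pos P'] have "0 < enn2real (pack_vol N S) / V ^ N" .
  then show "0 < enn2real (pack_vol N S)" using V by (simp add: zero_less_divide_iff)
  \<comment> \<open>The excess of \<open>t\<close> over \<open>\<alpha> * V\<close>, at most
    \<open>J\<close>, and the prefactor cost an amount that \<open>large(2)\<close> covers by one
    more \<open>\<alpha> * V\<close>; so \<open>D + 4\<close> becomes \<open>D + 5\<close>.\<close>
  have "- (D + 5) * (\<alpha> * V) \<le> - (D + 4) * (\<alpha> * V + real J) - ln (2 * (D + 1) * real J)"
    using large(2) by (simp add: algebra_simps)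
  also have "\<dots> \<le> - (D + 4) * real t - ln (2 * (D + 1) * real J)"
    using N t D by (intro diff_right_mono mult_left_mono_neg) auto
  also have "\<dots> = ln (exp (- (D + 4) * real t) / (2 * (D + 1) * real J))"
    using D J0 by (subst ln_div) auto
  also have "\<dots> \<le> ln (enn2real (pack_vol N S) / V ^ N)"
    using P' pos by (intro ln_mono) auto
  finally show "- (D + 5) * (\<alpha> * V) \<le> ln (enn2real (pack_vol N S) / V ^ N)" .
qed

section \<open>Conflicting pairs counted at one endpoint\<close>

text \<open>Each conflicting pair has an endpoint where \<open>N\<close> is at least as large as at
  the other, so it suffices to count, at each \<open>x\<close>, the conflicts with points of no
  larger \<open>N\<close>. In the application \<open>N\<close> is the distance to the
  centre.\<close>

lemma deg_le_twice:
  fixes N :: "'a \<Rightarrow> real"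
  assumes T [measurable]: "Measurable.pred M T" and N [measurable]: "N \<in> borel_measurable M"
    and lower: "\<And>x. x \<in> space M \<Longrightarrow> T x \<Longrightarrow> vol (\<lambda>u. (T u \<and> C x u) \<and> N u \<le> N x) \<le> \<epsilon>"
  shows "deg T \<le> 2 * \<epsilon> * vol T"
proof -
  let ?E = "\<lambda>x u. (T u \<and> C x u) \<and> N u \<le> N x"
  let ?L = "\<integral>\<^sup>+x. (\<integral>\<^sup>+u. of_bool (T x \<and> ?E x u) \<partial>M) \<partial>M"
  have meas: "(\<lambda>x. \<integral>\<^sup>+u. of_bool (T x \<and> ?E x u) \<partial>M) \<in> borel_measurable M"
    by (rule borel_measurable_nn_integral) (unfold case_prod_unfold, measurable)
  have meas': "(\<lambda>x. \<integral>\<^sup>+u. of_bool (T u \<and> ?E u x) \<partial>M) \<in> borel_measurable M"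
    by (rule borel_measurable_nn_integral) (unfold case_prod_unfold, measurable)
  interpret pair_sigma_finite M M ..
  have one: "(\<integral>\<^sup>+u. of_bool (P \<and> A u) \<partial>M) = of_bool P * vol A" if "Measurable.pred M A" for P A
    using that by (cases P) (simp_all add: nn_integral_of_bool)
  have [measurable]: "Measurable.pred M (?E x)" if "x \<in> space M" for x
    using that by measurable
  have "deg T \<le> (\<integral>\<^sup>+x. (\<integral>\<^sup>+u. of_bool (T x \<and> ?E x u) + of_bool (T u \<and> ?E u x) \<partial>M) \<partial>M)"
    unfolding deg_def
  proof (rule nn_integral_mono)
    fix x assume [measurable]: "x \<in> space M"
    have "of_bool (T x) * vol (\<lambda>u. T u \<and> C x u) = (\<integral>\<^sup>+u. of_bool (T x \<and> (T u \<and> C x u)) \<partial>M)"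
      by (rule one[symmetric]) measurable
    also have "\<dots> \<le> (\<integral>\<^sup>+u. of_bool (T x \<and> ?E x u) + of_bool (T u \<and> ?E u x) \<partial>M)"
      by (intro nn_integral_mono) (auto simp: of_bool_def C_sym)
    finally show "of_bool (T x) * vol (\<lambda>u. T u \<and> C x u) \<le>
        (\<integral>\<^sup>+u. of_bool (T x \<and> ?E x u) + of_bool (T u \<and> ?E u x) \<partial>M)" .
  qed
  also have "\<dots> = ?L + (\<integral>\<^sup>+x. (\<integral>\<^sup>+u. of_bool (T u \<and> ?E u x) \<partial>M) \<partial>M)"
  proof -
    have "(\<integral>\<^sup>+u. of_bool (T x \<and> ?E x u) + of_bool (T u \<and> ?E u x) \<partial>M) =
        (\<integral>\<^sup>+u. of_bool (T x \<and> ?E x u) \<partial>M) + (\<integral>\<^sup>+u. of_bool (T u \<and> ?E u x) \<partial>M)"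
      if [measurable]: "x \<in> space M" for x
      by (rule nn_integral_add; measurable)
    then show ?thesis using meas meas' by (simp add: nn_integral_add cong: nn_integral_cong)
  qed
  also have "(\<integral>\<^sup>+x. (\<integral>\<^sup>+u. of_bool (T u \<and> ?E u x) \<partial>M) \<partial>M) = ?L"
    by (rule Fubini') (unfold case_prod_unfold, measurable)
  also have "?L + ?L = 2 * ?L" by (simp add: mult_2)
  also have "?L \<le> (\<integral>\<^sup>+x. of_bool (T x) * \<epsilon> \<partial>M)"
  proof (rule nn_integral_mono)
    fix x assume x [measurable]: "x \<in> space M"
    have "(\<integral>\<^sup>+u. of_bool (T x \<and> ?E x u) \<partial>M) = of_bool (T x) * vol (?E x)"
      by (rule one) measurable
    also have "\<dots> \<le> of_bool (T x) * \<epsilon>" using lower[OF x] by (cases "T x") simp_all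
    finally show "(\<integral>\<^sup>+u. of_bool (T x \<and> ?E x u) \<partial>M) \<le> of_bool (T x) * \<epsilon>" .
  qed
  also have "\<dots> = vol T * \<epsilon>" by (simp add: nn_integral_multc nn_integral_of_bool)
  finally show ?thesis by (simp add: mult.assoc mult.commute[of \<epsilon>] mult_left_mono)
qed

end

section \<open>Uniform convexity of the mixed norm\<close>

text \<open>With \<open>\<kappa> = p * (p - 1) / 6\<close>, the function
  \<open>t powr p - \<kappa> * (t - 1)\<^sup>2\<close> is convex on \<open>{0<..<3}\<close>, because
  \<open>t powr (p - 2) \<ge> 3 powr (p - 2) \<ge> 1 / 3\<close> there; so it lies above its tangent
  at 1. The point \<open>t = 0\<close> is outside the open interval and is checked directly.\<close>

lemma powr_ge_tangent_parabola:
  fixes p t :: real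
  assumes p: "1 < p" "p \<le> 2" and t: "0 \<le> t" "t \<le> 2"
  shows "1 + p * (t - 1) + p * (p - 1) / 6 * (t - 1)\<^sup>2 \<le> t powr p"
proof (cases "t = 0")
  case True
  have "p * (p - 1) \<le> 2 * (p - 1)" using p by (intro mult_right_mono) auto
  then have "p * (p - 1) / 6 \<le> p - 1" using p by (simp only: pos_divide_le_eq) simp
  then show ?thesis using p True by simp
next
  case False
  define \<kappa> where "\<kappa> = p * (p - 1) / 6"
  define f where "f t = t powr p - \<kappa> * (t - 1)\<^sup>2" for t
  define f' where "f' t = p * t powr (p - 1) - 2 * \<kappa> * (t - 1)" for t
  define f'' where "f'' t = p * ((p - 1) * t powr (p - 2)) - 2 * \<kappa>" for t
  have f': "(f has_real_derivative f' t) (at t)" if "t \<in> {0<..<3}" for t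
    using that unfolding f_def f'_def
    by (auto intro!: derivative_eq_intros simp: algebra_simps)
  have "convex_on {0<..<3} f"
  proof (rule f''_ge0_imp_convex)
    fix t :: real assume t: "t \<in> {0<..<3}"
    show "(f has_real_derivative f' t) (at t)" by (rule f'[OF t])
    show "(f' has_real_derivative f'' t) (at t)"
      using t unfolding f'_def f''_def by (auto intro!: derivative_eq_intros)
    have "1 / 3 \<le> (3::real) powr (p - 2)"
      using p powr_mono[of "-1" "p - 2" "3::real"] by (simp add: powr_minus_divide)
    also have "\<dots> \<le> t powr (p - 2)" using t p by (intro powr_mono2') auto
    finally have "p * ((p - 1) * (1 / 3)) \<le> p * ((p - 1) * t powr (p - 2))"
      using p by (intro mult_left_mono) auto
    then show "0 \<le> f'' t" by (simp add: f''_def \<kappa>_def)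
  qed simp
  then have "f' 1 * (t - 1) \<le> f t - f 1"
    using False t has_field_derivative_at_within[OF f'[of 1]]
    by (intro convex_on_imp_above_tangent[where A = "{0<..<3}"]) (auto simp: interior_open)
  then show ?thesis by (simp add: f_def f'_def \<kappa>_def)
qed

text \<open>Write \<open>A = m * (1 + h)\<close> and \<open>B = m * (1 - h)\<close>. Adding the
  parabola bounds at \<open>1 + h\<close> and \<open>1 - h\<close> cancels the linear terms, and the
  exponent \<open>2 / p \<ge> 1\<close> only enlarges
  \<open>1 + \<kappa> * h\<^sup>2\<close>.\<close>

lemma power_mean_ge:
  fixes p A B :: real
  assumes p: "1 < p" "p \<le> 2" and AB: "0 \<le> A" "0 \<le> B"
  shows "((A + B) / 2)\<^sup>2 + p * (p - 1) / 6 * ((A - B) / 2)\<^sup>2 \<le> ((A powr p + B powr p) / 2) powr (2 / p)"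
proof (cases "A + B = 0")
  case True
  then show ?thesis using AB by (simp add: add_nonneg_eq_0_iff)
next
  case False
  define m where "m = (A + B) / 2"
  define h where "h = (A - B) / (A + B)"
  define \<kappa> where "\<kappa> = p * (p - 1) / 6"
  have m0: "0 < m" using AB False by (simp add: m_def)
  have h: "-1 \<le> h" "h \<le> 1" using AB m0 by (auto simp: h_def m_def field_simps)
  have A: "A = m * (1 + h)" and B: "B = m * (1 - h)" using False by (auto simp: m_def h_def field_simps)
  have hm: "(A - B) / 2 = m * h" unfolding A B by (simp add: algebra_simps)
  have "1 + p * h + \<kappa> * h\<^sup>2 \<le> (1 + h) powr p"
    using powr_ge_tangent_parabola[OF p, of "1 + h"] h by (simp add: \<kappa>_def)
  moreover have "1 - p * h + \<kappa> * h\<^sup>2 \<le> (1 - h) powr p"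
    using powr_ge_tangent_parabola[OF p, of "1 - h"] h by (simp add: \<kappa>_def)
  ultimately have "1 + \<kappa> * h\<^sup>2 \<le> ((1 + h) powr p + (1 - h) powr p) / 2" by argo
  then have le: "m powr p * (1 + \<kappa> * h\<^sup>2) \<le> (A powr p + B powr p) / 2"
    unfolding A B using m0 h by (simp add: powr_mult ring_distribs[symmetric] mult_left_mono)
  have k0: "0 \<le> \<kappa> * h\<^sup>2" using p by (simp add: \<kappa>_def)
  have "m\<^sup>2 * (1 + \<kappa> * h\<^sup>2) powr 1 \<le> m\<^sup>2 * (1 + \<kappa> * h\<^sup>2) powr (2 / p)"
    using p k0 by (intro mult_left_mono powr_mono) (auto simp: field_simps)
  also have "\<dots> = (m powr p * (1 + \<kappa> * h\<^sup>2)) powr (2 / p)"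
    using m0 k0 p by (simp add: powr_mult powr_powr)
  also have "\<dots> \<le> ((A powr p + B powr p) / 2) powr (2 / p)"
    using le p k0 by (intro powr_mono2) auto
  finally show ?thesis
    unfolding hm \<kappa>_def[symmetric] m_def[symmetric] using k0
    by (simp add: power_mult_distrib algebra_simps)
qed

section \<open>Convexity within one Euclidean block\<close>

lemma L2_set_parallelogram:
  "(L2_set (\<lambda>i. (a i + b i) / 2) I)\<^sup>2 + (L2_set (\<lambda>i. (a i - b i) / 2) I)\<^sup>2 =
    ((L2_set a I)\<^sup>2 + (L2_set b I)\<^sup>2) / 2"
  unfolding L2_set_def
  by (simp add: sum_nonneg sum.distrib[symmetric] sum_divide_distrib)
    (auto intro!: sum.cong simp: power2_eq_square field_simps)

lemma L2_set_uminus: "L2_set (\<lambda>i. - f i) I = L2_set f I"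
  by (simp add: L2_set_def)

lemma L2_set_half: "L2_set (\<lambda>i. f i / 2) I = L2_set f I / 2"
  using L2_set_right_distrib[of "1 / 2" f I] by (simp add: field_simps)

lemma L2_set_diff_bounds:
  "\<bar>L2_set a I - L2_set b I\<bar> \<le> L2_set (\<lambda>i. a i - b i) I"
  "L2_set (\<lambda>i. a i - b i) I \<le> L2_set a I + L2_set b I"
proof -
  have "L2_set a I \<le> L2_set (\<lambda>i. a i - b i) I + L2_set b I"
    using L2_set_triangle_ineq[of "\<lambda>i. a i - b i" b I] by simp
  moreover have "L2_set b I \<le> L2_set (\<lambda>i. a i - b i) I + L2_set a I"
    using L2_set_triangle_ineq[of "\<lambda>i. b i - a i" a I] L2_set_uminus[of "\<lambda>i. a i - b i" I] by simp
  ultimately show "\<bar>L2_set a I - L2_set b I\<bar> \<le> L2_set (\<lambda>i. a i - b i) I" by linarith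
  show "L2_set (\<lambda>i. a i - b i) I \<le> L2_set a I + L2_set b I"
    using L2_set_triangle_ineq[of a "\<lambda>i. - b i" I] by (simp add: L2_set_uminus)
qed

text \<open>For the norms \<open>u\<close> and \<open>w\<close> of half sum and half difference, the
  parallelogram law gives \<open>u\<^sup>2 + w\<^sup>2 = ((A + B) / 2)\<^sup>2 + ((A - B) /
  2)\<^sup>2\<close>. As \<open>\<bar>A - B\<bar> / 2 \<le> w\<close> and
  \<open>\<kappa> \<le> 1\<close>, lowering the coefficient of \<open>w\<^sup>2\<close> to
  \<open>\<kappa>\<close> reduces the first bound to \<open>power_mean_ge\<close>. The second
  follows from \<open>w \<le> (A + B) / 2\<close>.\<close>

lemma L2_set_power_mean_convexity:
  fixes p :: real and a b :: "'i \<Rightarrow> real" and I :: "'i set"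
  assumes p: "1 < p" "p \<le> 2"
  defines "s \<equiv> (L2_set a I powr p + L2_set b I powr p) / 2"
  shows "(L2_set (\<lambda>i. (a i + b i) / 2) I)\<^sup>2 + p * (p - 1) / 6 * (L2_set (\<lambda>i. (a i - b i) / 2) I)\<^sup>2
      \<le> s powr (2 / p)"
    and "L2_set (\<lambda>i. (a i - b i) / 2) I powr p \<le> s"
proof -
  define A where "A = L2_set a I"
  define B where "B = L2_set b I"
  define u where "u = L2_set (\<lambda>i. (a i + b i) / 2) I"
  define w where "w = L2_set (\<lambda>i. (a i - b i) / 2) I"
  define \<kappa> where "\<kappa> = p * (p - 1) / 6"
  have AB: "0 \<le> A" "0 \<le> B" by (auto simp: A_def B_def)
  have \<kappa>: "0 \<le> \<kappa>" "\<kappa> \<le> 1"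
    using p mult_mono[of p 2 "p - 1" 1] by (auto simp: \<kappa>_def)
  have w: "\<bar>(A - B) / 2\<bar> \<le> w" "w \<le> (A + B) / 2"
    using L2_set_diff_bounds[where a = a and b = b and I = I] by (auto simp: A_def B_def w_def L2_set_half)
  have sq: "((A - B) / 2)\<^sup>2 \<le> w\<^sup>2" using w(1) by (metis abs_le_square_iff abs_of_nonneg L2_set_nonneg w_def)
  have par: "u\<^sup>2 + w\<^sup>2 = ((A + B) / 2)\<^sup>2 + ((A - B) / 2)\<^sup>2"
    using L2_set_parallelogram[of a b I]
    by (simp add: u_def w_def A_def B_def power2_eq_square field_simps)
  have "(1 - \<kappa>) * ((A - B) / 2)\<^sup>2 \<le> (1 - \<kappa>) * w\<^sup>2" using sq \<kappa> by (intro mult_left_mono) auto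
  then have "u\<^sup>2 + \<kappa> * w\<^sup>2 \<le> ((A + B) / 2)\<^sup>2 + \<kappa> * ((A - B) / 2)\<^sup>2"
    using par unfolding left_diff_distrib by linarith
  also have "\<dots> \<le> s powr (2 / p)"
    using power_mean_ge[OF p AB] by (simp add: s_def A_def B_def \<kappa>_def)
  finally show "(L2_set (\<lambda>i. (a i + b i) / 2) I)\<^sup>2 + p * (p - 1) / 6 * (L2_set (\<lambda>i. (a i - b i) / 2) I)\<^sup>2
      \<le> s powr (2 / p)" by (simp add: u_def w_def \<kappa>_def)
  have s0: "0 \<le> s" by (simp add: s_def)
  have "w powr p \<le> ((A + B) / 2) powr p" using w p by (intro powr_mono2) (auto simp: w_def)
  also have "\<dots> = (((A + B) / 2)\<^sup>2) powr (p / 2)"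
    using AB by (cases "A + B = 0") (auto simp: powr_powr powr_numeral[symmetric] simp del: powr_numeral)
  also have "\<dots> \<le> (s powr (2 / p)) powr (p / 2)"
  proof (rule powr_mono2)
    have "((A + B) / 2)\<^sup>2 \<le> ((A + B) / 2)\<^sup>2 + \<kappa> * ((A - B) / 2)\<^sup>2" using \<kappa> by simp
    also have "\<dots> \<le> s powr (2 / p)"
      using power_mean_ge[OF p AB] by (simp add: s_def A_def B_def \<kappa>_def)
    finally show "((A + B) / 2)\<^sup>2 \<le> s powr (2 / p)" .
  qed (use p in auto)
  also have "\<dots> = s" using p s0 by (simp add: powr_powr)
  finally show "L2_set (\<lambda>i. (a i - b i) / 2) I powr p \<le> s" by (simp add: w_def)
qed

text \<open>Either the difference is negligible in this block or the midpoint gains a fixed factor.\<close>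
lemma block_convexity:
  fixes p \<tau> :: real
  assumes p: "1 < p" "p \<le> 2" and \<tau>: "0 < \<tau>" "\<tau> \<le> 1"
  obtains c where "0 < c" "c \<le> 1"
    "\<And>(a :: nat \<Rightarrow> real) b I. c * L2_set (\<lambda>i. (a i - b i) / 2) I powr p + L2_set (\<lambda>i. (a i + b i) / 2) I powr p \<le>
      (1 + c * \<tau>) * ((L2_set a I powr p + L2_set b I powr p) / 2)"
proof
  define \<kappa> where "\<kappa> = p * (p - 1) / 6"
  have \<kappa>: "0 < \<kappa>" "\<kappa> < 1"
    using p mult_mono[of p 2 "p - 1" 1] by (auto simp: \<kappa>_def)
  define x where "x = \<kappa> * \<tau> powr (2 / p)"
  have "\<tau> powr (2 / p) \<le> 1" using \<tau> p by (intro powr_le1) auto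
  then have x: "0 < x" "x < 1"
    using \<kappa> \<tau> mult_less_le_imp_less[of \<kappa> 1 "\<tau> powr (2 / p)" 1] by (auto simp: x_def)
  \<comment> \<open>If \<open>w powr p > \<tau> * s\<close>, then
    \<open>u\<^sup>2 \<le> (1 - x) * s powr (2 / p)\<close>; \<open>c\<close> is the resulting gain
    for \<open>u powr p\<close>.\<close>
  define c where "c = 1 - (1 - x) powr (p / 2)"
  have "(1 - x) powr (p / 2) < 1" using x p powr_less_mono2[of "p / 2" "1 - x" 1] by simp
  then show c: "0 < c" "c \<le> 1" by (auto simp: c_def)
  fix a b :: "nat \<Rightarrow> real" and I
  define s where "s = (L2_set a I powr p + L2_set b I powr p) / 2"
  define u where "u = L2_set (\<lambda>i. (a i + b i) / 2) I"
  define w where "w = L2_set (\<lambda>i. (a i - b i) / 2) I"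
  have 1: "u\<^sup>2 + \<kappa> * w\<^sup>2 \<le> s powr (2 / p)" and 2: "w powr p \<le> s"
    using L2_set_power_mean_convexity[OF p, where a = a and b = b and I = I] by (auto simp: s_def u_def w_def \<kappa>_def)
  have uw: "0 \<le> u" "0 \<le> w" and s0: "0 \<le> s" by (auto simp: u_def w_def s_def)
  have sq: "(y\<^sup>2) powr (p / 2) = y powr p" if "0 \<le> y" for y :: real
    using that by (cases "y = 0") (auto simp: powr_powr powr_numeral[symmetric] simp del: powr_numeral)
  have sp: "(s powr (2 / p)) powr (p / 2) = s" using p s0 by (simp add: powr_powr)
  show "c * w powr p + u powr p \<le> (1 + c * \<tau>) * s"
  proof (cases "w powr p \<le> \<tau> * s")
    case True
    have "0 \<le> \<kappa> * w\<^sup>2" using \<kappa> by simp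
    then have "u\<^sup>2 \<le> s powr (2 / p)" using 1 by linarith
    then have "(u\<^sup>2) powr (p / 2) \<le> (s powr (2 / p)) powr (p / 2)" using p by (intro powr_mono2) auto
    then have "u powr p \<le> s" by (simp add: sq uw sp)
    moreover have "c * w powr p \<le> c * (\<tau> * s)" using True c by (intro mult_left_mono) auto
    ultimately show ?thesis by (simp add: algebra_simps)
  next
    case False
    then have "(\<tau> * s) powr (2 / p) \<le> (w powr p) powr (2 / p)"
      using \<tau> s0 p by (intro powr_mono2) auto
    also have "\<dots> = w\<^sup>2" using p uw by (simp add: powr_powr)
    finally have "\<kappa> * (\<tau> * s) powr (2 / p) \<le> \<kappa> * w\<^sup>2" using \<kappa> by (intro mult_left_mono) auto
    then have "u\<^sup>2 \<le> s powr (2 / p) - \<kappa> * (\<tau> * s) powr (2 / p)" using 1 by linarith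
    also have "\<dots> = (1 - x) * s powr (2 / p)"
      using \<tau> s0 by (simp add: x_def powr_mult algebra_simps)
    finally have "(u\<^sup>2) powr (p / 2) \<le> ((1 - x) * s powr (2 / p)) powr (p / 2)"
      using p by (intro powr_mono2) auto
    then have "u powr p \<le> (1 - c) * s"
      using x by (simp add: sq uw powr_mult sp c_def)
    moreover have "c * w powr p \<le> c * s" using 2 c by (intro mult_left_mono) auto
    moreover have "0 \<le> c * \<tau> * s" using c \<tau> s0 by simp
    ultimately show ?thesis by (simp add: algebra_simps)
  qed
qed

section \<open>Summation over the blocks\<close>

lemma mixed_norm_L2: "mixed_norm p k m x = (\<Sum>j<m. L2_set x {k j..<k (Suc j)} powr p) powr (1 / p)"
  by (simp add: mixed_norm_def L2_set_def)

lemma powr_inverse_le_iff: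
  fixes p s \<rho> :: real
  assumes "0 < p" "0 \<le> s" "0 \<le> \<rho>"
  shows "s powr (1 / p) \<le> \<rho> \<longleftrightarrow> s \<le> \<rho> powr p"
proof
  assume "s powr (1 / p) \<le> \<rho>"
  then have "(s powr (1 / p)) powr p \<le> \<rho> powr p" using assms by (intro powr_mono2) auto
  then show "s \<le> \<rho> powr p" using assms by (simp add: powr_powr)
next
  assume "s \<le> \<rho> powr p"
  then have "s powr (1 / p) \<le> (\<rho> powr p) powr (1 / p)" using assms by (intro powr_mono2) auto
  then show "s powr (1 / p) \<le> \<rho>" using assms by (simp add: powr_powr)
qed

lemma mixed_norm_le_iff:
  "0 < p \<Longrightarrow> 0 \<le> \<rho> \<Longrightarrow> mixed_norm p k m x \<le> \<rho> \<longleftrightarrow>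
    (\<Sum>j<m. L2_set x {k j..<k (Suc j)} powr p) \<le> \<rho> powr p"
  unfolding mixed_norm_L2 by (intro powr_inverse_le_iff) (auto intro!: sum_nonneg)

text \<open>The block inequality is linear in \<open>p\<close>-th powers and can be summed over
  blocks without loss. Hence \<open>\<theta>\<close> depends on \<open>p\<close> alone, which is
  what yields one constant for all dimensions and partitions.\<close>

lemma mixed_norm_uniformly_convex:
  fixes p :: real
  assumes p: "1 < p" "p \<le> 2"
  obtains \<theta> where "1 / 2 \<le> \<theta>" "\<theta> < 1"
    "\<And>k m a b \<rho>. 0 \<le> \<rho> \<Longrightarrow> mixed_norm p k m a \<le> \<rho> \<Longrightarrow> mixed_norm p k m b \<le> \<rho> \<Longrightarrow>
      \<rho> / 2 \<le> mixed_norm p k m (\<lambda>i. a i - b i) \<Longrightarrow>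
      mixed_norm p k m (\<lambda>i. (a i + b i) / 2) \<le> \<theta> * \<rho>"
proof -
  \<comment> \<open>\<open>2 * \<tau> * \<rho> powr p = (\<rho> / 4) powr p\<close> bounds the
    \<open>p\<close>-th power of the norm of \<open>(a - b) / 2\<close> from below. The gain
    \<open>2 * c * \<tau>\<close> against the loss \<open>c * \<tau>\<close> leaves the factor
    \<open>1 - c * \<tau>\<close>.\<close>
  define \<tau> :: real where "\<tau> = (1 / 4) powr p / 2"
  have "(1 / 4) powr p \<le> (1::real)" using p by (intro powr_le1) auto
  then have \<tau>: "0 < \<tau>" "\<tau> \<le> 1" by (auto simp: \<tau>_def)
  obtain c where c: "0 < c" "c \<le> 1"
    and block: "\<And>(a :: nat \<Rightarrow> real) b I. c * L2_set (\<lambda>i. (a i - b i) / 2) I powr p + L2_set (\<lambda>i. (a i + b i) / 2) I powr p \<le>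
      (1 + c * \<tau>) * ((L2_set a I powr p + L2_set b I powr p) / 2)"
    using block_convexity[OF p \<tau>] by blast
  have ct: "0 < c * \<tau>" "c * \<tau> \<le> 1" using c \<tau> mult_mono[of c 1 \<tau> 1] by auto
  \<comment> \<open>The maximum with \<open>1 / 2\<close> serves \<open>sparse_conf\<close>: points
    farther apart than \<open>\<theta> * \<rho>\<close> are then at least \<open>\<rho> / 2\<close>
    apart.\<close>
  define \<theta> where "\<theta> = max (1 / 2) ((1 - c * \<tau>) powr (1 / p))"
  have "(1 - c * \<tau>) powr (1 / p) < 1"
    using powr_less_mono2[of "1 / p" "1 - c * \<tau>" 1] ct p by simp
  then have \<theta>: "1 / 2 \<le> \<theta>" "\<theta> < 1" by (auto simp: \<theta>_def)
  have "((1 - c * \<tau>) powr (1 / p)) powr p \<le> \<theta> powr p"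
    using p by (intro powr_mono2) (auto simp: \<theta>_def)
  then have \<theta>p: "1 - c * \<tau> \<le> \<theta> powr p" using p ct by (simp add: powr_powr)
  show thesis
  proof (rule that[OF \<theta>])
    fix k m a b and \<rho> :: real
    assume \<rho>: "0 \<le> \<rho>" and ab: "mixed_norm p k m a \<le> \<rho>" "mixed_norm p k m b \<le> \<rho>"
      and far: "\<rho> / 2 \<le> mixed_norm p k m (\<lambda>i. a i - b i)"
    let ?I = "\<lambda>j. {k j..<k (Suc j)}"
    define s where "s x = (\<Sum>j<m. L2_set x (?I j) powr p)" for x
    have sa: "s a \<le> \<rho> powr p" "s b \<le> \<rho> powr p"
      using ab p \<rho> by (auto simp: s_def mixed_norm_le_iff)
    have s0: "0 \<le> s x" for x unfolding s_def by (intro sum_nonneg) auto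
    have "(\<rho> / 2) powr p \<le> (s (\<lambda>i. a i - b i) powr (1 / p)) powr p"
      using far \<rho> p by (intro powr_mono2) (auto simp: mixed_norm_L2 s_def)
    also have "\<dots> = s (\<lambda>i. a i - b i)" using p s0 by (simp add: powr_powr)
    finally have "(1 / 2) powr p * (\<rho> / 2) powr p \<le> (1 / 2) powr p * s (\<lambda>i. a i - b i)"
      by (intro mult_left_mono) auto
    also have "\<dots> = s (\<lambda>i. (a i - b i) / 2)"
      unfolding s_def sum_distrib_left L2_set_half by (simp add: powr_divide)
    also have "(1 / 2) powr p * (\<rho> / 2) powr p = 2 * \<tau> * \<rho> powr p"
      using \<rho> by (simp add: \<tau>_def powr_mult[symmetric])
    finally have w: "2 * \<tau> * \<rho> powr p \<le> s (\<lambda>i. (a i - b i) / 2)" .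
    have "c * s (\<lambda>i. (a i - b i) / 2) + s (\<lambda>i. (a i + b i) / 2) =
        (\<Sum>j<m. c * L2_set (\<lambda>i. (a i - b i) / 2) (?I j) powr p + L2_set (\<lambda>i. (a i + b i) / 2) (?I j) powr p)"
      by (simp add: s_def sum.distrib sum_distrib_left)
    also have "\<dots> \<le> (\<Sum>j<m. (1 + c * \<tau>) * ((L2_set a (?I j) powr p + L2_set b (?I j) powr p) / 2))"
      by (intro sum_mono block)
    also have "\<dots> = (1 + c * \<tau>) * ((s a + s b) / 2)"
      unfolding sum_distrib_left[symmetric] s_def sum.distrib[symmetric] sum_divide_distrib ..
    also have "\<dots> \<le> (1 + c * \<tau>) * \<rho> powr p"
      using sa ct by (intro mult_left_mono) auto
    finally have "c * s (\<lambda>i. (a i - b i) / 2) + s (\<lambda>i. (a i + b i) / 2) \<le> (1 + c * \<tau>) * \<rho> powr p" .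
    moreover have "c * (2 * \<tau> * \<rho> powr p) \<le> c * s (\<lambda>i. (a i - b i) / 2)"
      using w c by (intro mult_left_mono) auto
    ultimately have "s (\<lambda>i. (a i + b i) / 2) \<le> (1 - c * \<tau>) * \<rho> powr p"
      by (simp add: algebra_simps)
    also have "\<dots> \<le> \<theta> powr p * \<rho> powr p" using \<theta>p by (intro mult_right_mono) auto
    also have "\<dots> = (\<theta> * \<rho>) powr p" using \<theta> \<rho> by (simp add: powr_mult)
    finally show "mixed_norm p k m (\<lambda>i. (a i + b i) / 2) \<le> \<theta> * \<rho>"
      using p \<theta> \<rho> by (subst mixed_norm_le_iff) (auto simp: s_def)
  qed
qed

section \<open>Volumes of balls\<close>

interpretation lborel_tuples: product_sigma_finite "\<lambda>_::nat. lborel :: real measure"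
  by (simp add: product_sigma_finite_def lborel.sigma_finite_measure_axioms)

lemma space_Rn: "space (Rn n) = PiE {..<n} (\<lambda>_. UNIV)"
  by (simp add: Rn_def space_PiM)

lemma sigma_finite_Rn: "sigma_finite_measure (Rn n)"
  unfolding Rn_def by (rule lborel_tuples.sigma_finite) simp

lemma component_Rn_measurable [measurable]: "i < n \<Longrightarrow> (\<lambda>x. x i) \<in> borel_measurable (Rn n)"
  unfolding Rn_def using measurable_component_singleton[of i "{..<n}" "\<lambda>_. lborel :: real measure"]
  by simp

definition affine_tuple :: "nat \<Rightarrow> real \<Rightarrow> (nat \<Rightarrow> real) \<Rightarrow> (nat \<Rightarrow> real) \<Rightarrow> nat \<Rightarrow> real" where
  "affine_tuple n c b x = (\<lambda>i\<in>{..<n}. b i + c * x i)"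

lemma affine_tuple_measurable: "affine_tuple n c b \<in> Rn n \<rightarrow>\<^sub>M Rn n"
  unfolding affine_tuple_def
proof (subst (2) Rn_def, rule measurable_restrict)
  fix i assume "i \<in> {..<n}"
  then have [measurable]: "(\<lambda>x. x i) \<in> borel_measurable (Rn n)" by simp
  show "(\<lambda>x. b i + c * x i) \<in> Rn n \<rightarrow>\<^sub>M lborel" by simp
qed

lemma emeasure_lborel_affine_vimage:
  assumes c: "0 < c" and A: "A \<in> sets (lborel :: real measure)"
  shows "ennreal c * emeasure lborel ((\<lambda>x. t + c * x) -` A) = emeasure lborel A"
proof -
  have "emeasure lborel A = emeasure (density (distr lborel borel (\<lambda>x. t + c * x)) (\<lambda>_. ennreal \<bar>c\<bar>)) A"
    using c by (subst lborel_real_affine[of c t]) auto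
  also have "\<dots> = ennreal c * emeasure (distr lborel borel (\<lambda>x. t + c * x)) A"
    using c A by (subst emeasure_density_const) auto
  also have "\<dots> = ennreal c * emeasure lborel ((\<lambda>x. t + c * x) -` A)"
    using A by (subst emeasure_distr) auto
  finally show ?thesis ..
qed

text \<open>Both sides are measures that agree on boxes, where the scaling acts
  coordinatewise.\<close>

lemma emeasure_Rn_affine:
  assumes c: "0 < c" and A: "A \<in> sets (Rn n)"
  shows "emeasure (Rn n) A = ennreal (c ^ n) * emeasure (Rn n) (affine_tuple n c b -` A \<inter> space (Rn n))"
proof -
  define P where "P = scale_measure (ennreal (c ^ n)) (distr (Rn n) (Rn n) (affine_tuple n c b))"
  have "P = (Pi\<^sub>M {..<n} (\<lambda>_. lborel))"
  proof (rule lborel_tuples.PiM_eqI)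
    show "sets P = sets (Pi\<^sub>M {..<n} (\<lambda>_. lborel))" by (simp add: P_def Rn_def)
    fix B :: "nat \<Rightarrow> real set" assume B: "\<And>i. i \<in> {..<n} \<Longrightarrow> B i \<in> sets lborel"
    let ?V = "\<lambda>i. (\<lambda>x. b i + c * x) -` B i"
    have V: "?V i \<in> sets lborel" if "i < n" for i
    proof -
      have "(\<lambda>x. b i + c * x) \<in> borel \<rightarrow>\<^sub>M borel" by measurable
      from measurable_sets[OF this, of "B i"] show ?thesis using B[of i] that by simp
    qed
    have "affine_tuple n c b -` PiE {..<n} B \<inter> space (Rn n) = PiE {..<n} ?V"
      by (auto simp: affine_tuple_def space_Rn PiE_iff extensional_def)
    moreover have "PiE {..<n} B \<in> sets (Rn n)"
      unfolding Rn_def by (intro sets_PiM_I_finite B) auto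
    ultimately have "emeasure P (PiE {..<n} B) = ennreal (c ^ n) * emeasure (Rn n) (PiE {..<n} ?V)"
      by (simp add: P_def emeasure_distr affine_tuple_measurable)
    also have "\<dots> = ennreal (c ^ n) * (\<Prod>i<n. emeasure lborel (?V i))"
      unfolding Rn_def using V by (subst lborel_tuples.emeasure_PiM) auto
    also have "\<dots> = (\<Prod>i<n. ennreal c * emeasure lborel (?V i))"
      using c by (simp add: prod.distrib ennreal_power)
    also have "\<dots> = (\<Prod>i<n. emeasure lborel (B i))"
      using c B by (intro prod.cong emeasure_lborel_affine_vimage) auto
    finally show "emeasure P (PiE {..<n} B) = (\<Prod>i\<in>{..<n}. emeasure lborel (B i))" .
  qed simp
  then have "emeasure (Rn n) A = emeasure P A" by (simp add: Rn_def)
  also have "\<dots> = ennreal (c ^ n) * emeasure (Rn n) (affine_tuple n c b -` A \<inter> space (Rn n))"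
    using A by (simp add: P_def emeasure_distr affine_tuple_measurable)
  finally show ?thesis .
qed

section \<open>The block norm and the radius of the ball of volume one\<close>

locale blocks =
  fixes p :: real and k :: "nat \<Rightarrow> nat" and m n :: nat
  assumes p: "1 < p" and valid: "valid_blocks m k n" and n: "1 \<le> n"
begin

abbreviation norm\<^sub>m :: "(nat \<Rightarrow> real) \<Rightarrow> real" where "norm\<^sub>m \<equiv> mixed_norm p k m"

lemma k_le_n: "j \<le> m \<Longrightarrow> k j \<le> n"
proof -
  have "k (m - d) \<le> n" for d
  proof (induction d)
    case 0
    then show ?case using valid by (simp add: valid_blocks_def)
  next
    case (Suc d)
    show ?case
    proof (cases "d < m")
      case True
      then have "k (m - Suc d) < k (Suc (m - Suc d))" using valid by (simp add: valid_blocks_def)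
      also have "Suc (m - Suc d) = m - d" using True by simp
      finally show ?thesis using Suc by simp
    qed (use Suc in simp)
  qed
  from this[of "m - j"] show "j \<le> m \<Longrightarrow> k j \<le> n" by simp
qed

lemma block_of:
  assumes "i < n"
  obtains j where "j < m" "i \<in> {k j..<k (Suc j)}"
proof -
  have "i < k d \<Longrightarrow> \<exists>j<d. i \<in> {k j..<k (Suc j)}" if "d \<le> m" for d
    using that
  proof (induction d)
    case 0
    then show ?case using valid by (simp add: valid_blocks_def)
  next
    case (Suc d)
    then show ?case by (cases "i < k d") (auto intro: less_SucI)
  qed
  from this[of m] assms valid show ?thesis by (auto simp: valid_blocks_def intro: that)
qed

text \<open>Points are extensional functions, while differences of points are plain functions; only
  coordinates below \<open>n\<close> count.\<close>

lemma mixed_norm_cong: "(\<And>i. i < n \<Longrightarrow> x i = y i) \<Longrightarrow> norm\<^sub>m x = norm\<^sub>m y"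
  unfolding mixed_norm_def
  by (intro arg_cong[where f = "\<lambda>s. s powr (1 / p)"] sum.cong refl
      arg_cong[where f = "\<lambda>s. sqrt s powr p"])
    (use k_le_n[OF Suc_leI] in force)

lemma mixed_norm_scale: "0 < c \<Longrightarrow> norm\<^sub>m (\<lambda>i. c * x i) = c * norm\<^sub>m x"
  using p unfolding mixed_norm_L2
  by (simp add: L2_set_right_distrib[symmetric] powr_mult sum_distrib_left[symmetric] powr_powr sum_nonneg)

lemma mixed_norm_minus_commute: "norm\<^sub>m (\<lambda>i. x i - y i) = norm\<^sub>m (\<lambda>i. y i - x i)"
  unfolding mixed_norm_def by (simp add: power2_commute)

lemma abs_le_mixed_norm:
  assumes "i < n"
  shows "\<bar>x i\<bar> \<le> norm\<^sub>m x"
proof -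
  obtain j where j: "j < m" "i \<in> {k j..<k (Suc j)}" using block_of[OF assms] .
  have "\<bar>x i\<bar> powr p \<le> L2_set x {k j..<k (Suc j)} powr p"
    using member_le_L2_set[OF _ j(2), of "\<lambda>i. \<bar>x i\<bar>"] p
    by (intro powr_mono2) (auto simp: L2_set_def)
  also have "\<dots> \<le> (\<Sum>j<m. L2_set x {k j..<k (Suc j)} powr p)"
    using j by (intro member_le_sum) auto
  finally have "(\<bar>x i\<bar> powr p) powr (1 / p) \<le> norm\<^sub>m x"
    unfolding mixed_norm_L2 using p by (intro powr_mono2) auto
  then show ?thesis using p by (simp add: powr_powr)
qed

lemma mixed_norm_measurable:
  assumes "\<And>i. i < n \<Longrightarrow> (\<lambda>z. f z i) \<in> borel_measurable K"
  shows "(\<lambda>z. norm\<^sub>m (f z)) \<in> borel_measurable K"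
proof -
  have [measurable]: "(\<lambda>z. \<Sum>i\<in>{k j..<k (Suc j)}. (f z i)\<^sup>2) \<in> borel_measurable K" if "j < m" for j
    using k_le_n[of "Suc j"] that by (intro borel_measurable_sum borel_measurable_power assms) auto
  have [measurable]: "(\<lambda>z. \<Sum>j<m. sqrt (\<Sum>i\<in>{k j..<k (Suc j)}. (f z i)\<^sup>2) powr p) \<in> borel_measurable K"
    by (intro borel_measurable_sum) simp
  show ?thesis unfolding mixed_norm_def by measurable
qed

lemma mdist_measurable:
  assumes [measurable]: "f \<in> K \<rightarrow>\<^sub>M Rn n" "g \<in> K \<rightarrow>\<^sub>M Rn n"
  shows "(\<lambda>z. mdist p k m (f z) (g z)) \<in> borel_measurable K"
  unfolding mdist_def
proof (rule mixed_norm_measurable)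
  fix i assume "i < n"
  then have [measurable]: "(\<lambda>x. x i) \<in> borel_measurable (Rn n)" by simp
  show "(\<lambda>z. g z i - f z i) \<in> borel_measurable K" by measurable
qed

lemma mball_sets: "mball p k m n x r \<in> sets (Rn n)"
proof -
  have [measurable]: "(\<lambda>y. mdist p k m x y) \<in> borel_measurable (Rn n)"
    unfolding mdist_def
  proof (rule mixed_norm_measurable)
    fix i assume "i < n"
    then have [measurable]: "(\<lambda>x. x i) \<in> borel_measurable (Rn n)" by simp
    show "(\<lambda>z. z i - x i) \<in> borel_measurable (Rn n)" by measurable
  qed
  show ?thesis unfolding mball_def by measurable
qed

definition unit_vol :: ennreal where "unit_vol = emeasure (Rn n) (mball p k m n (\<lambda>_. 0) 1)"

text \<open>The centre \<open>x\<close> is an arbitrary function, so centres found later need no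
  proof of membership in \<open>space (Rn n)\<close>.\<close>

lemma emeasure_mball:
  assumes r: "0 < r"
  shows "emeasure (Rn n) (mball p k m n x r) = ennreal (r ^ n) * unit_vol"
proof -
  have "affine_tuple n r x -` mball p k m n x r \<inter> space (Rn n) = mball p k m n (\<lambda>_. 0) 1"
  proof -
    have "mdist p k m x (affine_tuple n r x y) = r * norm\<^sub>m y" for y
      unfolding mdist_def mixed_norm_scale[OF r, symmetric]
      by (rule mixed_norm_cong) (simp add: affine_tuple_def)
    then show ?thesis
      using r by (auto simp: mball_def mdist_def affine_tuple_def space_Rn)
  qed
  then show ?thesis
    unfolding unit_vol_def using emeasure_Rn_affine[OF r mball_sets[of x r], of x] by simp
qed

lemma unit_vol_finite: "unit_vol < \<infinity>"
proof -
  have "mball p k m n (\<lambda>_. 0) 1 \<subseteq> PiE {..<n} (\<lambda>_. {-1..1})"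
  proof
    fix y assume y: "y \<in> mball p k m n (\<lambda>_. 0) 1"
    have "\<bar>y i\<bar> \<le> 1" if "i < n" for i
      using abs_le_mixed_norm[OF that, of y] y by (simp add: mball_def mdist_def)
    then show "y \<in> PiE {..<n} (\<lambda>_. {-1..1})"
      using y by (auto simp: mball_def space_Rn PiE_iff abs_le_iff minus_le_iff)
  qed
  then have "unit_vol \<le> emeasure (Rn n) (PiE {..<n} (\<lambda>_. {-1..1}))"
    unfolding unit_vol_def Rn_def by (intro emeasure_mono sets_PiM_I_finite) auto
  also have "\<dots> = (\<Prod>i<n. emeasure lborel {-1..1::real})"
    unfolding Rn_def by (subst lborel_tuples.emeasure_PiM) auto
  also have "\<dots> < \<infinity>" by (simp add: ennreal_power[symmetric] power_less_top_ennreal)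
  finally show ?thesis .
qed

text \<open>Otherwise the integer dilates of the unit ball would be null sets covering the whole
  space.\<close>

lemma unit_vol_pos: "0 < unit_vol"
proof (rule ccontr)
  assume "\<not> ?thesis"
  then have "emeasure (Rn n) (mball p k m n (\<lambda>_. 0) (real (Suc i))) = 0" for i
    by (subst emeasure_mball) auto
  then have "emeasure (Rn n) (\<Union>i. mball p k m n (\<lambda>_. 0) (real (Suc i))) = 0"
    by (intro emeasure_UN_eq_0) (auto intro: mball_sets)
  moreover have "(\<Union>i. mball p k m n (\<lambda>_. 0) (real (Suc i))) = space (Rn n)"
  proof -
    have "\<exists>i. norm\<^sub>m x \<le> real (Suc i)" for x
      using real_arch_simple[of "norm\<^sub>m x"] by (metis le_SucI of_nat_le_iff order_refl order_trans)
    then show ?thesis by (auto simp: mball_def mdist_def)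
  qed
  moreover have "emeasure (Rn n) (space (Rn n)) = (\<Prod>i<n. \<infinity>)"
    unfolding space_Rn unfolding Rn_def by (subst lborel_tuples.emeasure_PiM) auto
  ultimately show False by simp
qed

text \<open>Ball volumes are \<open>r ^ n * v\<close> with \<open>0 < v < \<infinity>\<close>, so
  exactly one radius has volume 1 and the \<open>THE\<close> in \<open>rad\<close> denotes
  it.\<close>

lemma rad: "0 < rad p k m n" "ennreal (rad p k m n ^ n) * unit_vol = 1"
proof -
  define v where "v = enn2real unit_vol"
  have v: "unit_vol = ennreal v" "0 < v"
    using unit_vol_finite unit_vol_pos by (auto simp: v_def enn2real_positive_iff)
  have eq: "emeasure (Rn n) (mball p k m n (\<lambda>_. 0) r) = ennreal (r ^ n * v)" if "0 < r" for r
    using emeasure_mball[OF that] v that by (simp add: ennreal_mult)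
  define r where "r = root n (1 / v)"
  have r: "0 < r" "r ^ n * v = 1" using v n by (auto simp: r_def)
  have "rad p k m n = r"
    unfolding rad_def
  proof (rule the_equality)
    show "0 < r \<and> emeasure (Rn n) (mball p k m n (\<lambda>_. 0) r) = 1" using r by (simp add: eq)
    fix r' assume r': "0 < r' \<and> emeasure (Rn n) (mball p k m n (\<lambda>_. 0) r') = 1"
    then have "ennreal (r' ^ n * v) = 1" using eq[of r'] by simp
    then have "r' ^ n * v = 1" by (simp only: ennreal_eq_1)
    then have "r' ^ n = r ^ n" using r v by (metis mult_right_cancel less_irrefl)
    then show "r' = r" using r r' n by (intro power_eq_imp_eq_base[of r' n r]) auto
  qed
  with r v show "0 < rad p k m n" "ennreal (rad p k m n ^ n) * unit_vol = 1"
    by (auto simp: ennreal_mult[symmetric])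
qed

lemma emeasure_mball_rad:
  assumes r: "0 < r"
  shows "emeasure (Rn n) (mball p k m n x r) = ennreal ((r / rad p k m n) ^ n)"
proof -
  have "ennreal (r ^ n) = ennreal ((r / rad p k m n) ^ n) * ennreal (rad p k m n ^ n)"
    using r rad(1) by (simp add: ennreal_mult[symmetric] power_divide)
  then show ?thesis
    using rad(2) by (simp add: emeasure_mball[OF r] mult.assoc)
qed

section \<open>Entropy density\<close>

text \<open>Strict, as the negation of the distance condition in \<open>Zhat\<close>.\<close>

definition conf :: "(nat \<Rightarrow> real) \<Rightarrow> (nat \<Rightarrow> real) \<Rightarrow> bool" where
  "conf x y \<longleftrightarrow> mdist p k m x y < 2 * rad p k m n"

lemma mdist_commute: "mdist p k m x y = mdist p k m y x"
  unfolding mdist_def by (rule mixed_norm_minus_commute)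

sublocale hc: conflict_space "Rn n" conf
proof (intro conflict_space.intro conflict_space_axioms.intro sigma_finite_Rn)
  show "conf x y \<longleftrightarrow> conf y x" for x y by (simp add: conf_def mdist_commute)
  have [measurable]: "(\<lambda>z. mdist p k m (fst z) (snd z)) \<in> borel_measurable (Rn n \<Otimes>\<^sub>M Rn n)"
    by (rule mdist_measurable) simp_all
  show "Measurable.pred (Rn n \<Otimes>\<^sub>M Rn n) (\<lambda>(x, y). conf x y)"
    unfolding conf_def case_prod_unfold by measurable
qed

lemma vol_le_mball:
  assumes "0 < r" "\<And>u. u \<in> space (Rn n) \<Longrightarrow> A u \<Longrightarrow> mdist p k m x u \<le> r"
  shows "hc.vol A \<le> ennreal ((r / rad p k m n) ^ n)"
  unfolding hc.vol_def emeasure_mball_rad[OF assms(1), of x, symmetric]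
  by (intro emeasure_mono mball_sets) (auto simp: mball_def assms(2))

lemma vol_conf_le: "hc.vol (\<lambda>u. S u \<and> conf x u) \<le> ennreal (2 ^ n)"
  using vol_le_mball[of "2 * rad p k m n" "\<lambda>u. S u \<and> conf x u" x] rad(1) by (simp add: conf_def)

text \<open>By \<open>deg_le_twice\<close> it suffices to consider, for \<open>x\<close> in
  \<open>T\<close>, the conflicting points \<open>u\<close> no farther from \<open>v\<close> than
  \<open>x\<close>. If \<open>x\<close> is within \<open>\<theta> * \<rho>\<close> of
  \<open>v\<close>, so is \<open>u\<close>. Otherwise \<open>x\<close> and \<open>v\<close> are at
  least \<open>\<rho> / 2\<close> apart and \<open>u\<close> is within \<open>\<rho>\<close> of
  both, so convexity puts \<open>u\<close> within \<open>\<theta> * \<rho>\<close> of their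
  midpoint. Either ball has volume \<open>(2 * \<theta>) ^ n\<close>, against \<open>2 ^ n\<close>
  for a full neighbourhood.\<close>

lemma sparse_conf:
  assumes \<theta>: "1 / 2 \<le> \<theta>"
    and convex: "\<And>a b \<rho>. 0 \<le> \<rho> \<Longrightarrow> norm\<^sub>m a \<le> \<rho> \<Longrightarrow> norm\<^sub>m b \<le> \<rho> \<Longrightarrow> \<rho> / 2 \<le> norm\<^sub>m (\<lambda>i. a i - b i) \<Longrightarrow>
      norm\<^sub>m (\<lambda>i. (a i + b i) / 2) \<le> \<theta> * \<rho>"
  shows "hc.sparse S (2 * (2 * \<theta>) ^ n)"
  unfolding hc.sparse_def
proof (intro ballI allI impI)
  fix v T
  assume v: "v \<in> space (Rn n)" and T: "Measurable.pred (Rn n) T" and sub: "\<forall>u. T u \<longrightarrow> S u \<and> conf v u"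
  define \<rho> where "\<rho> = 2 * rad p k m n"
  have \<rho>: "0 < \<rho>" "\<theta> * \<rho> / rad p k m n = 2 * \<theta>" using rad(1) by (auto simp: \<rho>_def)
  have "hc.deg T \<le> 2 * ennreal ((2 * \<theta>) ^ n) * hc.vol T"
  proof (rule hc.deg_le_twice[OF T, where N = "mdist p k m v"])
    show "mdist p k m v \<in> borel_measurable (Rn n)"
      using mdist_measurable[OF measurable_const[OF v] measurable_ident_sets[OF refl]] by simp
    fix x assume x: "x \<in> space (Rn n)" "T x"
    have "\<exists>w. \<forall>u. (T u \<and> conf x u) \<and> mdist p k m v u \<le> mdist p k m v x \<longrightarrow> mdist p k m w u \<le> \<theta> * \<rho>"
    proof (cases "mdist p k m v x \<le> \<theta> * \<rho>")
      case True
      then show ?thesis by (intro exI[of _ v]) auto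
    next
      case False
      have "mdist p k m (\<lambda>i. (v i + x i) / 2) u \<le> \<theta> * \<rho>" if "T u" "conf x u" for u
      proof -
        have "norm\<^sub>m (\<lambda>i. u i - v i) \<le> \<rho>" "norm\<^sub>m (\<lambda>i. u i - x i) \<le> \<rho>"
          using that sub by (auto simp: conf_def mdist_def \<rho>_def less_imp_le)
        moreover have "1 / 2 * \<rho> \<le> \<theta> * \<rho>" using \<theta> \<rho> by (intro mult_right_mono) auto
        then have "\<rho> / 2 \<le> norm\<^sub>m (\<lambda>i. (u i - v i) - (u i - x i))"
          using False by (simp add: mdist_def)
        ultimately have "norm\<^sub>m (\<lambda>i. ((u i - v i) + (u i - x i)) / 2) \<le> \<theta> * \<rho>"
          using \<rho> by (intro convex) auto
        moreover have "(\<lambda>i. ((u i - v i) + (u i - x i)) / 2) = (\<lambda>i. u i - (v i + x i) / 2)"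
          by (simp add: field_simps)
        ultimately show ?thesis by (simp only: mdist_def)
      qed
      then show ?thesis by blast
    qed
    then obtain w where "\<And>u. (T u \<and> conf x u) \<and> mdist p k m v u \<le> mdist p k m v x \<Longrightarrow> mdist p k m w u \<le> \<theta> * \<rho>"
      by blast
    then show "hc.vol (\<lambda>u. (T u \<and> conf x u) \<and> mdist p k m v u \<le> mdist p k m v x) \<le> ennreal ((2 * \<theta>) ^ n)"
      using vol_le_mball[of "\<theta> * \<rho>" _ w] \<rho> \<theta> by simp
  qed
  then show "hc.deg T \<le> ennreal (2 * (2 * \<theta>) ^ n) * hc.vol T"
    using \<theta> by (simp add: ennreal_mult)
qed

lemma Zhat_eq:
  assumes S: "S \<in> sets (Rn n)"
  shows "Zhat p k m n S t = enn2real (hc.pack_vol t (\<lambda>u. u \<in> S)) / fact t"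
proof -
  let ?P = "Pi\<^sub>M {..<t} (\<lambda>_. Rn n)"
  have S': "Measurable.pred (Rn n) (\<lambda>u. u \<in> S)" using S by measurable
  have pk: "Measurable.pred ?P (hc.packing t (\<lambda>u. u \<in> S))"
    by (rule hc.packing_measurable[OF hc.pred_const_param[OF S'], where f = "\<lambda>_. undefined"
          and P = "count_space UNIV"]) simp_all
  have "hc.pack_vol t (\<lambda>u. u \<in> S) = (\<integral>\<^sup>+X. indicator {X \<in> space ?P. hc.packing t (\<lambda>u. u \<in> S) X} X \<partial>?P)"
    unfolding hc.pack_vol_def by (intro nn_integral_cong) (auto simp: indicator_def)
  also have "\<dots> = emeasure ?P {X \<in> space ?P. hc.packing t (\<lambda>u. u \<in> S) X}"
    using pk by (intro nn_integral_indicator) (simp add: pred_def)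
  finally have Q: "enn2real (hc.pack_vol t (\<lambda>u. u \<in> S)) = measure ?P {X \<in> space ?P. hc.packing t (\<lambda>u. u \<in> S) X}"
    by (simp add: measure_def)
  show ?thesis
  proof (cases "t = 0")
    case False
    then show ?thesis
      unfolding Q by (simp add: Zhat_def hc.packing_def conf_def not_less)
  qed (simp add: Zhat_def)
qed

text \<open>\<open>packing_entropy\<close> is used with \<open>\<Delta> = 2 ^ n\<close> and
  \<open>\<delta> = 2 * (2 * \<theta>) ^ n\<close>. Its two size conditions hold for all large
  \<open>R\<close>, since \<open>V\<close> tends to infinity while \<open>D\<close> and
  \<open>J\<close> stay fixed.\<close>

lemma entropy_density_ge:
  assumes \<theta>: "1 / 2 \<le> \<theta>"
    and convex: "\<And>a b \<rho>. 0 \<le> \<rho> \<Longrightarrow> norm\<^sub>m a \<le> \<rho> \<Longrightarrow> norm\<^sub>m b \<le> \<rho> \<Longrightarrow> \<rho> / 2 \<le> norm\<^sub>m (\<lambda>i. a i - b i) \<Longrightarrow>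
      norm\<^sub>m (\<lambda>i. (a i + b i) / 2) \<le> \<theta> * \<rho>"
    and D: "0 < D" "\<theta> ^ n \<le> exp (- 4 * D)"
    and large: "832 * exp 2 * (D * (D + 1)\<^sup>2 * exp (- D)) \<le> 1"
  shows "ereal (- (D + 5)) \<le> entropy_density p k m n (D / 2 ^ n)"
proof -
  define \<alpha> where "\<alpha> = D / 2 ^ n"
  define J where "J = nat \<lceil>12 * (D + 1)\<rceil>"
  have \<alpha>: "0 < \<alpha>" using D by (simp add: \<alpha>_def)
  \<comment> \<open>Rounding up adds less than \<open>1 \<le> D + 1\<close>.\<close>
  have J: "12 * (D + 1) \<le> real J" "real J \<le> 13 * (D + 1)" using D by (auto simp: J_def) linarith+
  \<comment> \<open>\<open>\<alpha> * \<delta> = 2 * D * \<theta> ^ n\<close>, and the decay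
    \<open>exp (- 4 * D)\<close> beats \<open>exp D\<close> from the weight and
    \<open>exp (2 * (D + 1))\<close> from the tangent bound. What remains is
    \<open>exp (2 - D)\<close> times a polynomial, with \<open>832 = 64 * 13\<close>.\<close>
  have small: "16 * exp D * \<alpha> * (2 * (2 * \<theta>) ^ n) / 2 * real J * (4 * (D + 1)) * exp (2 * (D + 1)) \<le> 1"
  proof -
    have "exp D * exp (- 4 * D) * exp (2 * (D + 1)) = exp 2 * exp (- D)"
      by (simp add: exp_add[symmetric])
    then have exps: "exp 2 * exp (- D) = exp D * exp (- 4 * D) * exp (2 * (D + 1))" ..
    have "16 * exp D * \<alpha> * (2 * (2 * \<theta>) ^ n) / 2 * real J * (4 * (D + 1)) * exp (2 * (D + 1)) =
        64 * D * (D + 1) * (exp D * \<theta> ^ n * exp (2 * (D + 1))) * real J"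
      unfolding \<alpha>_def power_mult_distrib by simp
    also have "\<dots> \<le> 64 * D * (D + 1) * (exp 2 * exp (- D)) * real J"
      unfolding exps using D by (intro mult_left_mono mult_right_mono) auto
    also have "\<dots> \<le> 64 * D * (D + 1) * (exp 2 * exp (- D)) * (13 * (D + 1))"
      using D J by (intro mult_left_mono) auto
    also have "\<dots> = 832 * exp 2 * (D * (D + 1)\<^sup>2 * exp (- D))" by (simp add: power2_eq_square)
    finally show ?thesis using large by linarith
  qed
  have lim: "filterlim (Vol p k m n) at_top at_top"
    unfolding Vol_def
  proof (rule filterlim_pow_at_top)
    show "filterlim (\<lambda>R. R / rad p k m n) at_top at_top"
      using filterlim_tendsto_pos_mult_at_top[OF tendsto_const _ filterlim_ident, of "1 / rad p k m n"]
        rad(1) by simp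
  qed (use n in simp)
  have "eventually (\<lambda>R. ereal (- (D + 5)) \<le> entropy_term p k m n \<alpha> R) at_top"
    using eventually_gt_at_top[of 0]
      lim[unfolded filterlim_at_top, rule_format, of "(2 ^ n * real J + real J / (8 * \<alpha>)) * (8 / 3)"]
      lim[unfolded filterlim_at_top, rule_format, of "((D + 4) * real J + ln (2 * (D + 1) * real J)) / \<alpha>"]
  proof eventually_elim
    case (elim R)
    let ?S = "mball p k m n (\<lambda>_. 0) R"
    define V where "V = Vol p k m n R"
    define N where "N = nat \<lfloor>\<alpha> * V\<rfloor>"
    have V: "hc.vol (\<lambda>u. u \<in> ?S) = ennreal V" "0 < V"
    proof -
      have "{u \<in> space (Rn n). u \<in> ?S} = ?S" by (auto simp: mball_def)
      then show "hc.vol (\<lambda>u. u \<in> ?S) = ennreal V"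
        using elim(1) by (simp add: hc.vol_def emeasure_mball_rad V_def Vol_def)
      show "0 < V" using elim(1) rad(1) by (simp add: V_def Vol_def)
    qed
    have ent: "0 < enn2real (hc.pack_vol N (\<lambda>u. u \<in> ?S))"
      "- (D + 5) * (\<alpha> * V) \<le> ln (enn2real (hc.pack_vol N (\<lambda>u. u \<in> ?S)) / V ^ N)"
    proof -
      have S: "Measurable.pred (Rn n) (\<lambda>u. u \<in> ?S)" using mball_sets by measurable
      have l1: "2 ^ n * real J + real J / (8 * \<alpha>) \<le> 3 / 8 * V"
        using elim(2) by (simp add: V_def)
      have l2: "(D + 4) * real J + ln (2 * (D + 1) * real J) \<le> \<alpha> * V"
        using elim(3) \<alpha> by (simp add: V_def field_simps)
      have \<delta>: "0 \<le> 2 * (2 * \<theta>) ^ n" using \<theta> by simp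
      note * = hc.packing_entropy[OF S V _ vol_conf_le sparse_conf[OF \<theta> convex] \<delta> D(1) \<alpha>_def J(1) small l1 l2,
          folded N_def]
      show "0 < enn2real (hc.pack_vol N (\<lambda>u. u \<in> ?S))" by (rule *(1)) simp_all
      show "- (D + 5) * (\<alpha> * V) \<le> ln (enn2real (hc.pack_vol N (\<lambda>u. u \<in> ?S)) / V ^ N)" by (rule *(2)) simp_all
    qed
    have "- (D + 5) \<le> 1 / (\<alpha> * V) * ln (enn2real (hc.pack_vol N (\<lambda>u. u \<in> ?S)) / V ^ N)"
      using ent(2) \<alpha> V(2) by (simp add: field_simps)
    moreover have "Zhat p k m n ?S N = enn2real (hc.pack_vol N (\<lambda>u. u \<in> ?S)) / fact N"
      by (rule Zhat_eq[OF mball_sets])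
    ultimately show ?case
      using ent(1) unfolding entropy_term_def Let_def V_def[symmetric] N_def[symmetric] by simp
  qed
  then show ?thesis
    unfolding entropy_density_def \<alpha>_def[symmetric] by (rule Liminf_bounded)
qed

end

section \<open>Choice of the constants, with small dimensions treated apart\<close>

theorem theorem18:
  shows "\<forall>p::real. 1 < p \<and> p \<le> 2 \<longrightarrow>
    (\<exists>c::real. 0 < c \<and> c < 2 \<and>
      (\<exists>\<eta> \<eta>' :: nat \<Rightarrow> real. \<eta> \<longlonglongrightarrow> 0 \<and> \<eta>' \<longlonglongrightarrow> 0 \<and>
        (\<forall>n::nat. n \<ge> 1 \<longrightarrow> (\<forall>m::nat. \<forall>k::nat \<Rightarrow> nat. valid_blocks m k n \<longrightarrow>
          (\<exists>\<alpha>::real. \<alpha> = (1 + \<eta> n) * (ln (2 / c) * real n / 2 ^ n) \<and>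
             entropy_density p k m n \<alpha> \<ge> ereal (- (1 + \<eta>' n) * ln (2 / c) * real n))))))"
proof (intro allI impI, elim conjE)
  fix p :: real assume p: "1 < p" "p \<le> 2"
  obtain \<theta> where \<theta>: "1 / 2 \<le> \<theta>" "\<theta> < 1"
    and convex: "\<And>k m a b \<rho>. 0 \<le> \<rho> \<Longrightarrow> mixed_norm p k m a \<le> \<rho> \<Longrightarrow> mixed_norm p k m b \<le> \<rho> \<Longrightarrow>
      \<rho> / 2 \<le> mixed_norm p k m (\<lambda>i. a i - b i) \<Longrightarrow>
      mixed_norm p k m (\<lambda>i. (a i + b i) / 2) \<le> \<theta> * \<rho>"
    using mixed_norm_uniformly_convex[OF p] by blast
  \<comment> \<open>Then \<open>\<theta> ^ n = exp (- 4 * (L * n))\<close>, so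
    \<open>D = L * n\<close> meets the decay condition, and \<open>c = 2 * exp (- L)\<close> makes
    \<open>ln (2 / c) = L\<close>.\<close>
  define L where "L = - ln \<theta> / 4"
  define c where "c = 2 * exp (- L)"
  have L: "0 < L" using \<theta> by (simp add: L_def)
  have "2 / c = exp L" by (simp add: c_def exp_minus field_simps)
  moreover have "exp (- L) < 1" using L by simp
  ultimately have c: "0 < c" "c < 2" "ln (2 / c) = L" by (simp_all add: c_def)
  have "((\<lambda>D::real. D * (D + 1)\<^sup>2 * exp (- D)) \<longlongrightarrow> 0) at_top" by real_asymp
  then have "((\<lambda>D::real. 832 * exp 2 * (D * (D + 1)\<^sup>2 * exp (- D))) \<longlongrightarrow> 832 * exp 2 * 0) at_top"
    by (intro tendsto_mult tendsto_const)
  then have "eventually (\<lambda>D::real. 832 * exp 2 * (D * (D + 1)\<^sup>2 * exp (- D)) < 1) at_top"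
    by (rule order_tendstoD) simp
  then obtain D0 where D0: "\<And>D::real. D0 \<le> D \<Longrightarrow> 832 * exp 2 * (D * (D + 1)\<^sup>2 * exp (- D)) < 1"
    by (auto simp: eventually_at_top_linorder)
  txt \<open>For the finitely many \<open>n\<close> with \<open>L * n < D0\<close> a density of at most \<open>D1 / 2 ^ n\<close> is used instead.\<close>
  define D1 :: real where "D1 = exp (- 2) / 3328"
  have "exp (- 2) \<le> (1::real)" by simp
  then have D1: "0 < D1" "D1 \<le> 1" unfolding D1_def by (simp, linarith)
  have small: "832 * exp 2 * (D * (D + 1)\<^sup>2 * exp (- D)) \<le> 1" if "0 < D" "D \<le> D1" for D
  proof -
    \<comment> \<open>For \<open>D \<le> D1 \<le> 1\<close> the bracket is at most
      \<open>4 * D1\<close>; with \<open>3328 = 4 * 832\<close> the final value is exactly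
      1.\<close>
    have "(D + 1)\<^sup>2 \<le> 2\<^sup>2" using that D1 by (intro power_mono) auto
    then have "D * (D + 1)\<^sup>2 * exp (- D) \<le> D1 * 4 * 1"
      using that D1 by (intro mult_mono) auto
    then have "832 * exp 2 * (D * (D + 1)\<^sup>2 * exp (- D)) \<le> 832 * exp 2 * (D1 * 4 * 1)"
      by (intro mult_left_mono) auto
    also have "\<dots> = 1" by (simp add: D1_def exp_minus)
    finally show ?thesis .
  qed
  define d where "d n = (if D0 \<le> L * real n then L * real n else min (L * real n) D1)" for n
  \<comment> \<open>\<open>\<eta>\<close> is the relative deviation of \<open>d n\<close> from
    \<open>L * n\<close>, eventually 0; \<open>\<eta>'\<close> expresses the additive constant 5 as
    a relative error.\<close>
  define \<eta> where "\<eta> n = d n / (L * real n) - 1" for n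
  define \<eta>' where "\<eta>' n = 5 / (L * real n)" for n
  have ev: "eventually (\<lambda>n. D0 \<le> L * real n) sequentially"
    using L by real_asymp
  have "eventually (\<lambda>n. \<eta> n = 0) sequentially"
    using ev eventually_gt_at_top[of 0]
    by eventually_elim (use L in \<open>simp add: \<eta>_def d_def\<close>)
  then have lim: "\<eta> \<longlonglongrightarrow> 0" by (rule tendsto_eventually)
  have lim': "\<eta>' \<longlonglongrightarrow> 0"
    unfolding \<eta>'_def using L by real_asymp
  have main: "ereal (- (1 + \<eta>' n) * L * real n) \<le> entropy_density p k m n ((1 + \<eta> n) * (L * real n / 2 ^ n))"
    if n: "1 \<le> n" and k: "valid_blocks m k n" for n m k
  proof -
    interpret blocks p k m n using p n k by unfold_locales
    have Ln: "0 < L * real n" using L n by simp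
    have d: "0 < d n" "d n \<le> L * real n" using Ln D1 by (auto simp: d_def)
    have "832 * exp 2 * (d n * (d n + 1)\<^sup>2 * exp (- d n)) \<le> 1"
      using D0[of "d n"] small[of "d n"] d by (auto simp: d_def)
    moreover have "\<theta> ^ n \<le> exp (- 4 * d n)"
    proof -
      have "\<theta> ^ n = exp (real n * ln \<theta>)" using \<theta> by (simp add: exp_of_nat_mult)
      also have "real n * ln \<theta> = - 4 * (L * real n)" by (simp add: L_def)
      finally show ?thesis using d by simp
    qed
    ultimately have "ereal (- (d n + 5)) \<le> entropy_density p k m n (d n / 2 ^ n)"
      using \<theta> convex d by (intro entropy_density_ge) auto
    moreover have "ereal (- (1 + \<eta>' n) * L * real n) \<le> ereal (- (d n + 5))"
    proof -
      \<comment> \<open>As \<open>d n \<le> L * n\<close> in every case, the bound obtained for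
        \<open>d n\<close> is at least as strong as the required one.\<close>
      have "(1 + \<eta>' n) * (L * real n) = L * real n + 5"
        using L n by (simp add: \<eta>'_def distrib_right)
      moreover have "- (1 + \<eta>' n) * L * real n = - ((1 + \<eta>' n) * (L * real n))"
        by (simp only: minus_mult_left mult.assoc)
      ultimately have "- (1 + \<eta>' n) * L * real n \<le> - (d n + 5)" using d by linarith
      then show ?thesis by (simp only: ereal_less_eq)
    qed
    moreover have "(1 + \<eta> n) * (L * real n / 2 ^ n) = d n / 2 ^ n" using L n by (simp add: \<eta>_def)
    ultimately show ?thesis by (simp only:)
  qed
  show "\<exists>c::real. 0 < c \<and> c < 2 \<and>
      (\<exists>\<eta> \<eta>' :: nat \<Rightarrow> real. \<eta> \<longlonglongrightarrow> 0 \<and> \<eta>' \<longlonglongrightarrow> 0 \<and>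
        (\<forall>n::nat. n \<ge> 1 \<longrightarrow> (\<forall>m::nat. \<forall>k::nat \<Rightarrow> nat. valid_blocks m k n \<longrightarrow>
          (\<exists>\<alpha>::real. \<alpha> = (1 + \<eta> n) * (ln (2 / c) * real n / 2 ^ n) \<and>
             entropy_density p k m n \<alpha> \<ge> ereal (- (1 + \<eta>' n) * ln (2 / c) * real n)))))"
  proof (rule exI[of _ c], intro conjI c(1,2), rule exI[of _ \<eta>], rule exI[of _ \<eta>'],
      intro conjI allI impI lim lim')
    fix n m k assume "1 \<le> n" "valid_blocks m k n"
    from main[OF this] show "\<exists>\<alpha>::real. \<alpha> = (1 + \<eta> n) * (ln (2 / c) * real n / 2 ^ n) \<and>
        entropy_density p k m n \<alpha> \<ge> ereal (- (1 + \<eta>' n) * ln (2 / c) * real n)"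
      unfolding c(3) by blast
  qed
qed

end
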